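(* Let $m\ge 3$ be an odd integer, let $k\ge 0$ be an integer, put $N=k+\frac{m-1}{2}$, and let $P_k:\mathbb R^m\to\mathbb R_{0,m}$ be a nonzero homogeneous monogenic polynomial of degree $k$. Let $a<b$ and $0<c<d$ be real numbers and put $$\Omega=\left\{(x_0,\underline x)\in\mathbb R^{m+1}:\ (x_0,|\underline x|)\in[a,b]\times[c,d]\right\}.$$ Let $$H(x_0,\underline x)=\bigl(A(x_0,r)+\underline\omega\,B(x_0,r)\bigr)P_k(\underline x)$$ be an arbitrary axial monogenic function of degree $k$ in $\Omega$. Then Fueter primitives of $H$ exist, i.e. there are holomorphic functions $h(z)=u(x,y)+iv(x,y)$ ($z=x+iy$) on $[a,b]\times[c,d]$ with $\mathsf{Ft}[h(z),P_k(\underline x)]=H$ in $\Omega$. Moreover, the Fueter primitives of $H$ are given by $h=u+iv$ with $$u(x_0,r)=K_N\int_c^r t(r^2-t^2)^{N-1}A(x_0,t)\,dt+\sum_{j=0}^{N-1}\alpha_j(x_0)r^{2j},$$ $$v(x_0,r)=K_N\,r\int_c^r(r^2-t^2)^{N-1}B(x_0,t)\,dt+\sum_{j=0}^{N-1}\beta_j(x_0)r^{2j+1},$$ where $$K_N=\frac{1}{2N\left((2N-2)!!\right)^2},$$ and where the $\mathbb R$-valued functions $\alpha_j(x_0)$ and $\beta_j(x_0)$, $j=0,\dots,N-1$, of $x_0\in[a,b]$ satisfy the differential equations $$\alpha_j'(x_0)-(2j+1)\beta_j(x_0)=(-1)^{N-j-1}K_N\binom{N-1}{j}c^{2(N-j)-1}B(x_0,c),\qquad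 j=0,\dots,N-1,$$ $$\beta_j'(x_0)+2(j+1)\alpha_{j+1}(x_0)=(-1)^{N-j}K_N\binom{N-1}{j}c^{2(N-j-1)}A(x_0,c),\qquad j=0,\dots,N-2,$$ $$\beta_{N-1}'(x_0)=-K_N\,A(x_0,c).$$ That is, $h=u+iv$ is a Fueter primitive of $H$ if and only if $u$ and $v$ have this form with $\alpha_j,\beta_j$ satisfying these equations.
   Context: Clifford algebra: $\mathbb R_{0,m}$ is the real Clifford algebra generated by the standard basis $e_1,\dots,e_m$ of $\mathbb R^m$ with $e_je_k+e_ke_j=-2\delta_{jk}$. A point $(x_0,\underline x)=(x_0,x_1,\dots,x_m)\in\mathbb R^{m+1}$ is identified with the paravector $x_0+\underline x$, $\underline x=\sum_{j=1}^m x_je_j$. Write $r=|\underline x|$ and $\underline\omega=\underline x/r$ for $\underline x\neq 0$. Monogenic functions: $\partial_{\underline x}=\sum_{j=1}^m e_j\partial_{x_j}$ is the Dirac operator. A continuously differentiable $\mathbb R_{0,m}$-valued function $f$ on an open set of $\mathbb R^{m+1}$ (resp. $\mathbb R^m$) is monogenic if $(\partial_{x_0}+\partial_{\underline x})f=0$ (resp. $\partial_{\underline x}f=0$). A homogeneous monogenic polynomial of degree $k$ in $\mathbb R^m$ is an $\mathbb R_{0,m}$-valued polynomial $P_k(\underline x)$, homogeneous of degree $k$, with $\partial_{\underline x}P_k=0$. Axial monogenic functions: an axial monogenic function of degree $k$ (with respect to $P_k$) is a monogenic function of the form $\bigl(A(x_0,r)+\underline\omega B(x_0,r)\bigr)P_k(\underline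 x)$, where $A,B$ are $\mathbb R$-valued continuously differentiable functions satisfying the Vekua-type system $$\partial_{x_0}A-\partial_rB=\frac{2k+m-1}{r}B,\qquad \partial_{x_0}B+\partial_rA=0.$$ Fueter mapping: for $h(z)=u(x,y)+iv(x,y)$ holomorphic ($z=x+iy$, $u,v$ real-valued) in a subset of the upper half-plane $y>0$, $$\mathsf{Ft}[h(z),P_k(\underline x)](x_0,\underline x)=\Delta^{k+\frac{m-1}{2}}\bigl[\bigl(u(x_0,r)+\underline\omega\,v(x_0,r)\bigr)P_k(\underline x)\bigr],\qquad \Delta=\sum_{j=0}^m\partial_{x_j}^2 .$$ A Fueter primitive of $H$ is a holomorphic function $h$ with $\mathsf{Ft}[h(z),P_k(\underline x)]=H$. Conventions: $n!!$ is the double factorial, with $0!!=1$. Points $(x,y)$ of the plane are identified with $z=x+iy$. A function is said to be monogenic, axial monogenic or holomorphic on a set that is not open if it is so in some open neighbourhood of it (for axial monogenic functions, with $A,B$ defined and satisfying the system in a neighbourhood of $[a,b]\times[c,d]$). *)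

theory Defs
  imports "HOL-Analysis.Analysis"
begin

section \<open>The Clifford algebra $R_{0,m}$\<close>

text \<open>
  The index type \<open>'m\<close> has \<open>m = CARD('m)\<close> elements. A Clifford number is given by its
  coordinates with respect to the blades
  \<open>e\<^sub>A = e\<^bsub>a1\<^esub> \<dots> e\<^bsub>as\<^esub>\<close> with \<open>A = {a1 < \<dots> < as}\<close>. The linear order on \<open>'m\<close> serves only
  to fix this basis. The multiplication that \<open>HOL-Analysis\<close> provides on \<open>real ^ 'n\<close> is the
  componentwise one and is not used here.
\<close>

type_synonym 'm rvec = "(real, 'm) vec"
type_synonym 'm paravector = "real \<times> 'm rvec"
type_synonym 'm clifford = "(real, 'm set) vec"

definition blade :: "'m::finite set \<Rightarrow> 'm clifford" where
  "blade A = axis A 1"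

abbreviation cl_gen :: "'m::finite \<Rightarrow> 'm clifford" where
  "cl_gen j \<equiv> blade {j}"

text \<open>
  Sorting \<open>e\<^sub>A e\<^sub>B\<close> costs one sign for every pair \<open>b < a\<close> (anticommutation) and one for
  every common index (square \<open>-1\<close>).
\<close>

definition cl_sign :: "'m::{finite,linorder} set \<Rightarrow> 'm set \<Rightarrow> real" where
  "cl_sign A B = (\<Prod>a\<in>A. \<Prod>b\<in>B. if b \<le> a then - 1 else 1)"

definition cl_mult ::
  "'m::{finite,linorder} clifford \<Rightarrow> 'm clifford \<Rightarrow> 'm clifford"  (infixl "\<cdot>\<^sub>C" 70) where
  "x \<cdot>\<^sub>C y = (\<Sum>A\<in>UNIV. \<Sum>B\<in>UNIV. (cl_sign A B * x $ A * y $ B) *\<^sub>R blade (sym_diff A B))"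

definition cl_scalar :: "real \<Rightarrow> 'm::finite clifford" where
  "cl_scalar t = t *\<^sub>R blade {}"

definition cl_vector :: "'m rvec \<Rightarrow> 'm::finite clifford" where
  "cl_vector x = (\<Sum>j\<in>UNIV. x $ j *\<^sub>R cl_gen j)"

lemma cl_mult_add_left: "(x + y) \<cdot>\<^sub>C z = x \<cdot>\<^sub>C z + y \<cdot>\<^sub>C z"
  by (simp add: cl_mult_def algebra_simps sum.distrib)

lemma cl_mult_add_right: "x \<cdot>\<^sub>C (y + z) = x \<cdot>\<^sub>C y + x \<cdot>\<^sub>C z"
  by (simp add: cl_mult_def algebra_simps sum.distrib)

lemma cl_mult_scaleR_left: "(t *\<^sub>R x) \<cdot>\<^sub>C y = t *\<^sub>R (x \<cdot>\<^sub>C y)"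
  by (simp add: cl_mult_def scaleR_sum_right mult_ac)

lemma cl_mult_scaleR_right: "x \<cdot>\<^sub>C (t *\<^sub>R y) = t *\<^sub>R (x \<cdot>\<^sub>C y)"
  by (simp add: cl_mult_def scaleR_sum_right mult_ac)

lemma bilinear_cl_mult: "bilinear (\<cdot>\<^sub>C)"
  by (simp add: bilinear_def linear_iff cl_mult_add_left cl_mult_add_right
      cl_mult_scaleR_left cl_mult_scaleR_right)

lemma blade_mult: "blade A \<cdot>\<^sub>C blade B = cl_sign A B *\<^sub>R blade (sym_diff A B)"
proof -
  have "(cl_sign A' B' * blade A $ A' * blade B $ B') *\<^sub>R blade (sym_diff A' B')
      = (if A' = A then if B' = B then cl_sign A B *\<^sub>R blade (sym_diff A B) else 0 else 0)"
    for A' B' by (auto simp: blade_def axis_def)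
  then show ?thesis
    by (simp add: cl_mult_def if_distrib[where f = "\<lambda>f. f _"] cong: if_cong)
       (subst sum.swap, simp)
qed

lemma cl_gen_anticommute:
  "cl_gen j \<cdot>\<^sub>C cl_gen l + cl_gen l \<cdot>\<^sub>C cl_gen j = cl_scalar (if j = l then - 2 else 0)"
  by (auto simp: blade_mult cl_sign_def cl_scalar_def Un_commute
      simp flip: scaleR_add_left scaleR_minus_left)

lemma clifford_eq_sum_blade: "x = (\<Sum>A\<in>UNIV. x $ A *\<^sub>R blade A)"
  by (simp add: vec_eq_iff blade_def axis_def if_distrib cong: if_cong)

lemma cl_sign_sym_diff_left: "cl_sign (sym_diff A B) C = cl_sign A C * cl_sign B C"
proof -
  define f where "f = (\<lambda>a. \<Prod>c\<in>C. if c \<le> a then - 1 else (1::real))"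
  have sq: "f a * f a = 1" for a
    by (auto simp: f_def simp flip: prod.distrib intro!: prod.neutral)
  have 1: "prod f A = prod f (A - B) * prod f (A \<inter> B)"
    by (subst prod.union_disjoint[symmetric]) (auto intro!: prod.cong)
  have 2: "prod f B = prod f (B - A) * prod f (A \<inter> B)"
    by (subst prod.union_disjoint[symmetric]) (auto intro!: prod.cong)
  have 3: "prod f (sym_diff A B) = prod f (A - B) * prod f (B - A)"
    by (subst prod.union_disjoint[symmetric]) auto
  have "prod f (A \<inter> B) * prod f (A \<inter> B) = 1"
    by (simp add: sq flip: prod.distrib)
  then show ?thesis
    unfolding cl_sign_def f_def[symmetric] 1 2 3 by (simp add: mult_ac)
qed

lemma cl_sign_sym_diff_right: "cl_sign A (sym_diff B C) = cl_sign A B * cl_sign A C"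
proof -
  define g where "g = (\<lambda>b. \<Prod>a\<in>A. if b \<le> a then - 1 else (1::real))"
  have sw: "cl_sign A B = prod g B" for B
    unfolding cl_sign_def g_def by (rule prod.swap)
  have sq: "g a * g a = 1" for a
    by (auto simp: g_def simp flip: prod.distrib intro!: prod.neutral)
  have 1: "prod g B = prod g (B - C) * prod g (B \<inter> C)"
    by (subst prod.union_disjoint[symmetric]) (auto intro!: prod.cong)
  have 2: "prod g C = prod g (C - B) * prod g (B \<inter> C)"
    by (subst prod.union_disjoint[symmetric]) (auto intro!: prod.cong)
  have 3: "prod g (sym_diff B C) = prod g (B - C) * prod g (C - B)"
    by (subst prod.union_disjoint[symmetric]) auto
  have "prod g (B \<inter> C) * prod g (B \<inter> C) = 1"
    by (simp add: sq flip: prod.distrib)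
  then show ?thesis
    unfolding sw 1 2 3 by (simp add: mult_ac)
qed

lemma blade_mult_assoc: "(blade A \<cdot>\<^sub>C blade B) \<cdot>\<^sub>C blade C = blade A \<cdot>\<^sub>C (blade B \<cdot>\<^sub>C blade C)"
proof -
  have "sym_diff (sym_diff A B) C = sym_diff A (sym_diff B C)"
    by auto
  then show ?thesis
    by (simp only: blade_mult cl_mult_scaleR_left cl_mult_scaleR_right
        cl_sign_sym_diff_left cl_sign_sym_diff_right scaleR_scaleR mult_ac)
qed

lemma cl_mult_sum_left: "(\<Sum>i\<in>I. f i) \<cdot>\<^sub>C z = (\<Sum>i\<in>I. f i \<cdot>\<^sub>C z)"
  by (rule linear_sum) (simp add: linear_iff cl_mult_add_left cl_mult_scaleR_left)

lemma cl_mult_sum_right: "z \<cdot>\<^sub>C (\<Sum>i\<in>I. f i) = (\<Sum>i\<in>I. z \<cdot>\<^sub>C f i)"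
  by (rule linear_sum) (simp add: linear_iff cl_mult_add_right cl_mult_scaleR_right)

lemma cl_mult_assoc: "(x \<cdot>\<^sub>C y) \<cdot>\<^sub>C z = x \<cdot>\<^sub>C (y \<cdot>\<^sub>C z)"
proof -
  have "((\<Sum>A\<in>UNIV. x $ A *\<^sub>R blade A) \<cdot>\<^sub>C (\<Sum>B\<in>UNIV. y $ B *\<^sub>R blade B)) \<cdot>\<^sub>C (\<Sum>C\<in>UNIV. z $ C *\<^sub>R blade C)
      = (\<Sum>A\<in>UNIV. x $ A *\<^sub>R blade A) \<cdot>\<^sub>C ((\<Sum>B\<in>UNIV. y $ B *\<^sub>R blade B) \<cdot>\<^sub>C (\<Sum>C\<in>UNIV. z $ C *\<^sub>R blade C))"
    by (simp only: cl_mult_sum_left cl_mult_sum_right cl_mult_scaleR_left cl_mult_scaleR_right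
        blade_mult_assoc)
  then show ?thesis
    by (simp only: clifford_eq_sum_blade[symmetric])
qed

lemma cl_mult_1_left: "cl_scalar 1 \<cdot>\<^sub>C x = x"
proof -
  have "blade {} \<cdot>\<^sub>C (\<Sum>A\<in>UNIV. x $ A *\<^sub>R blade A) = (\<Sum>A\<in>UNIV. x $ A *\<^sub>R blade A)"
    by (simp add: cl_mult_sum_right cl_mult_scaleR_right blade_mult cl_sign_def)
  then show ?thesis
    by (simp add: cl_scalar_def flip: clifford_eq_sum_blade)
qed

lemma cl_mult_1_right: "x \<cdot>\<^sub>C cl_scalar 1 = x"
proof -
  have "(\<Sum>A\<in>UNIV. x $ A *\<^sub>R blade A) \<cdot>\<^sub>C blade {} = (\<Sum>A\<in>UNIV. x $ A *\<^sub>R blade A)"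
    by (simp add: cl_mult_sum_left cl_mult_scaleR_left blade_mult cl_sign_def)
  then show ?thesis
    by (simp add: cl_scalar_def flip: clifford_eq_sum_blade)
qed


section \<open>Differential operators and monogenic functions\<close>

definition C1_on :: "('a::real_normed_vector \<Rightarrow> 'b::real_normed_vector) \<Rightarrow> 'a set \<Rightarrow> bool" where
  "C1_on f W \<longleftrightarrow>
    (\<exists>f'. (\<forall>p\<in>W. (f has_derivative blinfun_apply (f' p)) (at p)) \<and> continuous_on W f')"

definition partial_deriv ::
  "'a::real_normed_vector \<Rightarrow> ('a \<Rightarrow> 'b::real_normed_vector) \<Rightarrow> 'a \<Rightarrow> 'b" where
  "partial_deriv b f p = vector_derivative (\<lambda>t. f (p + t *\<^sub>R b)) (at 0)"

definition laplacian :: "('a::euclidean_space \<Rightarrow> 'b::real_normed_vector) \<Rightarrow> 'a \<Rightarrow> 'b" where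
  "laplacian f p = (\<Sum>b\<in>Basis. partial_deriv b (partial_deriv b f) p)"

definition dirac :: "('m rvec \<Rightarrow> 'm clifford) \<Rightarrow> 'm rvec \<Rightarrow> 'm::{finite,linorder} clifford" where
  "dirac f x = (\<Sum>j\<in>UNIV. cl_gen j \<cdot>\<^sub>C partial_deriv (axis j 1) f x)"

definition cauchy_riemann ::
  "('m paravector \<Rightarrow> 'm clifford) \<Rightarrow> 'm paravector \<Rightarrow> 'm::{finite,linorder} clifford" where
  "cauchy_riemann f p =
    partial_deriv (1, 0) f p + (\<Sum>j\<in>UNIV. cl_gen j \<cdot>\<^sub>C partial_deriv (0, axis j 1) f p)"

definition monogenic_on ::
  "('m paravector \<Rightarrow> 'm::{finite,linorder} clifford) \<Rightarrow> 'm paravector set \<Rightarrow> bool" where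
  "monogenic_on f W \<longleftrightarrow> open W \<and> C1_on f W \<and> (\<forall>p\<in>W. cauchy_riemann f p = 0)"

definition hom_monogenic_poly ::
  "nat \<Rightarrow> ('m rvec \<Rightarrow> 'm::{finite,linorder} clifford) \<Rightarrow> bool" where
  "hom_monogenic_poly k P \<longleftrightarrow>
    polynomial_function P \<and> (\<forall>t x. P (t *\<^sub>R x) = t ^ k *\<^sub>R P x) \<and> (\<forall>x. dirac P x = 0)"


section \<open>Axial monogenic functions\<close>

text \<open>A plane set \<open>S\<close> in the variables \<open>(x0, r)\<close>, rotated around the \<open>x0\<close>-axis.\<close>

definition axial_region :: "(real \<times> real) set \<Rightarrow> 'm::finite paravector set" where
  "axial_region S = {(x0, x). (x0, norm x) \<in> S}"

definition axial_fun ::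
  "(real \<times> real \<Rightarrow> real) \<Rightarrow> (real \<times> real \<Rightarrow> real) \<Rightarrow> ('m rvec \<Rightarrow> 'm clifford) \<Rightarrow>
    'm paravector \<Rightarrow> 'm::{finite,linorder} clifford" where
  "axial_fun A B P = (\<lambda>(x0, x).
    (cl_scalar (A (x0, norm x)) + B (x0, norm x) *\<^sub>R cl_vector (x /\<^sub>R norm x)) \<cdot>\<^sub>C P x)"

definition vekua_system ::
  "nat \<Rightarrow> nat \<Rightarrow> (real \<times> real \<Rightarrow> real) \<Rightarrow> (real \<times> real \<Rightarrow> real) \<Rightarrow> (real \<times> real) set \<Rightarrow> bool" where
  "vekua_system m k A B V \<longleftrightarrow> (\<forall>(x0, r)\<in>V.
    partial_deriv (1, 0) A (x0, r) - partial_deriv (0, 1) B (x0, r)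
      = (2 * real k + real m - 1) / r * B (x0, r) \<and>
    partial_deriv (1, 0) B (x0, r) + partial_deriv (0, 1) A (x0, r) = 0)"

text \<open>
  \<open>F = (A + \<omega> B) P\<close> is axial monogenic of degree \<open>k\<close> on the rotation of \<open>S\<close>; as \<open>S\<close> need not
  be open, everything is required on an open neighbourhood, which stays away from \<open>r = 0\<close>.
\<close>

definition axial_monogenic ::
  "nat \<Rightarrow> ('m rvec \<Rightarrow> 'm clifford) \<Rightarrow> (real \<times> real) set \<Rightarrow>
    (real \<times> real \<Rightarrow> real) \<Rightarrow> (real \<times> real \<Rightarrow> real) \<Rightarrow>
    ('m paravector \<Rightarrow> 'm::{finite,linorder} clifford) \<Rightarrow> bool" where
  "axial_monogenic k P S A B F \<longleftrightarrow> (\<exists>V. open V \<and> S \<subseteq> V \<and> V \<subseteq> UNIV \<times> {0<..} \<and>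
    C1_on A V \<and> C1_on B V \<and> vekua_system CARD('m) k A B V \<and>
    monogenic_on F (axial_region V) \<and>
    (\<forall>p\<in>axial_region V. F p = axial_fun A B P p))"


section \<open>The Fueter mapping\<close>

definition fueter_map ::
  "(complex \<Rightarrow> complex) \<Rightarrow> nat \<Rightarrow> ('m rvec \<Rightarrow> 'm clifford) \<Rightarrow>
    'm paravector \<Rightarrow> 'm::{finite,linorder} clifford" where
  "fueter_map h k P = (laplacian ^^ (k + (CARD('m) - 1) div 2))
    (axial_fun (\<lambda>(x, y). Re (h (Complex x y))) (\<lambda>(x, y). Im (h (Complex x y))) P)"

text \<open>
  A primitive is a function on \<open>S\<close> only: the values of \<open>h\<close> outside \<open>S\<close> are irrelevant, and
  holomorphy on \<open>S\<close> means that \<open>h\<close> on \<open>S\<close> is the restriction of a holomorphic function \<open>g\<close> on an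
  open neighbourhood of \<open>S\<close>. The derivatives in the Fueter mapping are those of \<open>g\<close>.
\<close>

definition fueter_primitive ::
  "nat \<Rightarrow> ('m rvec \<Rightarrow> 'm clifford) \<Rightarrow> (real \<times> real) set \<Rightarrow>
    ('m paravector \<Rightarrow> 'm::{finite,linorder} clifford) \<Rightarrow> (complex \<Rightarrow> complex) \<Rightarrow> bool" where
  "fueter_primitive k P S H h \<longleftrightarrow> (\<exists>U g. open U \<and> U \<subseteq> {z. Im z > 0} \<and>
    (\<forall>(x, y)\<in>S. Complex x y \<in> U \<and> g (Complex x y) = h (Complex x y)) \<and>
    g holomorphic_on U \<and>
    (\<forall>p\<in>axial_region S. fueter_map g k P p = H p))"

fun double_fact :: "nat \<Rightarrow> nat" where
  "double_fact 0 = 1"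
| "double_fact (Suc 0) = 1"
| "double_fact (Suc (Suc n)) = Suc (Suc n) * double_fact n"

definition fueter_const :: "nat \<Rightarrow> real" where
  "fueter_const N = 1 / (2 * real N * (real (double_fact (2 * N - 2)))\<^sup>2)"

end

theory Submission
  imports Defs "HOL-Complex_Analysis.Complex_Analysis"
begin

text \<open>
  Let \<open>\<delta> = r\<^sup>-\<^sup>1 \<partial>\<^sub>r\<close>. If \<open>P\<close> is monogenic, then \<open>P\<close> and \<open>x P\<close> are solid harmonics of degrees \<open>k\<close> and
  \<open>k + 1\<close>, and the Laplacian maps \<open>(\<delta>\<^sup>s u) P + (\<delta>\<^sup>s (v / r)) x P\<close> to \<open>2 (N - s)\<close> times the same expression with
  \<open>s + 1\<close>, for \<open>u + i v\<close> holomorphic. Hence \<open>u + i v\<close> is a Fueter primitive iff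
  \<open>(2 N)!! \<delta>\<^sup>N u = A\<close> and \<open>(2 N)!! \<delta>\<^sup>N (v / r) = B / r\<close>. Taylor's formula in the variable \<open>r\<^sup>2\<close> at
  \<open>c\<^sup>2\<close> turns these equations into the integral representation, with coefficients \<open>\<alpha>\<close>, \<open>\<beta>\<close> that are
  linear combinations of the values of \<open>\<delta>\<^sup>s u\<close> and \<open>\<delta>\<^sup>s (v / r)\<close> at \<open>r = c\<close>; the Cauchy-Riemann equations
  give the ODEs by telescoping. Conversely, the Poincare lemma undoes \<open>\<delta>\<close> one step at a time inside the
  Vekua systems, from index \<open>N\<close> down to the Cauchy-Riemann equations at index \<open>0\<close>. Each step leaves the
  values at one point free, so a primitive exists with any prescribed \<open>\<alpha>\<close>, \<open>\<beta>\<close> at \<open>a\<close>,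
  and solutions of the ODEs are determined by these values.
\<close>

section \<open>Harmonicity of monogenic polynomials\<close>

lemma cl_mult_zero_right: "x \<cdot>\<^sub>C 0 = 0"
  using cl_mult_scaleR_right[of x 0 0] by simp

lemma cl_mult_scalar_left: "cl_scalar t \<cdot>\<^sub>C x = t *\<^sub>R x"
  using cl_mult_scaleR_left[of t "cl_scalar 1" x] by (simp add: cl_mult_1_left) (simp add: cl_scalar_def)

lemma linear_cl_vector: "linear cl_vector"
  by (simp add: linear_iff cl_vector_def algebra_simps sum.distrib scaleR_sum_right)

lemma cl_vector_axis: "cl_vector (axis j 1) = cl_gen j"
  by (simp add: cl_vector_def axis_def if_distrib[where f = "\<lambda>x. x *\<^sub>R _"] cong: if_cong)

text \<open>Averaging the double sum with its swapped copy replaces the product of two generators by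
  half their anticommutator, so only the diagonal survives. For second derivatives this says that
  the square of the Dirac operator is minus the Laplacian; for products of coordinates it gives the
  square of a vector.\<close>

lemma cl_gen_double_sum:
  fixes F :: "'m \<Rightarrow> 'm \<Rightarrow> 'm::{finite,linorder} clifford"
  assumes sym: "\<And>i j. F i j = F j i"
  shows "(\<Sum>i\<in>UNIV. \<Sum>j\<in>UNIV. cl_gen i \<cdot>\<^sub>C (cl_gen j \<cdot>\<^sub>C F i j)) = - (\<Sum>j\<in>UNIV. F j j)"
    (is "?S = _")
proof -
  have "?S = (\<Sum>i\<in>UNIV. \<Sum>j\<in>UNIV. cl_gen j \<cdot>\<^sub>C (cl_gen i \<cdot>\<^sub>C F i j))"
    by (subst sum.swap) (simp add: sym)
  then have "?S + ?S = (\<Sum>i\<in>UNIV. \<Sum>j\<in>UNIV. (cl_gen i \<cdot>\<^sub>C cl_gen j + cl_gen j \<cdot>\<^sub>C cl_gen i) \<cdot>\<^sub>C F i j)"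
    by (simp add: cl_mult_add_left cl_mult_assoc sum.distrib)
  also have "\<dots> = (\<Sum>i\<in>UNIV. \<Sum>j\<in>UNIV. if i = j then (- 2) *\<^sub>R F i j else 0)"
    by (intro sum.cong refl) (simp add: cl_gen_anticommute cl_mult_scalar_left)
  also have "\<dots> = 2 *\<^sub>R (- (\<Sum>j\<in>UNIV. F j j))"
    by (simp add: scaleR_sum_right sum_negf)
  finally have "2 *\<^sub>R ?S = 2 *\<^sub>R (- (\<Sum>j\<in>UNIV. F j j))"
    by (simp only: scaleR_2)
  then show ?thesis
    by (simp only: scaleR_cancel_left) simp
qed

lemma cl_vector_sq: "cl_vector x \<cdot>\<^sub>C (cl_vector x \<cdot>\<^sub>C q) = - (norm x)\<^sup>2 *\<^sub>R q"
proof -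
  have "cl_vector x \<cdot>\<^sub>C (cl_vector x \<cdot>\<^sub>C q)
      = (\<Sum>i\<in>UNIV. \<Sum>j\<in>UNIV. cl_gen i \<cdot>\<^sub>C (cl_gen j \<cdot>\<^sub>C ((x $ i * x $ j) *\<^sub>R q)))"
    unfolding cl_vector_def
    by (simp add: cl_mult_sum_left cl_mult_sum_right cl_mult_scaleR_left cl_mult_scaleR_right
        scaleR_sum_right) (subst sum.swap, simp add: mult.commute)
  also have "\<dots> = - (\<Sum>j\<in>UNIV. (x $ j * x $ j) *\<^sub>R q)"
    by (rule cl_gen_double_sum) (simp add: mult.commute)
  also have "\<dots> = - (norm x)\<^sup>2 *\<^sub>R q"
    by (simp add: power2_norm_eq_inner inner_vec_def flip: scaleR_sum_left)
  finally show ?thesis .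
qed

text \<open>Multiplying the combination on the left by \<open>\<alpha>\<close> minus
  \<open>\<gamma>\<close> times the vector leaves the real factor \<alpha>^2 + \<gamma>^2 |x|^2 in
  front of \<open>q\<close>. Coefficients can thus be compared although the algebra may have zero
  divisors.\<close>

lemma cl_vector_independent:
  assumes "\<alpha> *\<^sub>R q + \<gamma> *\<^sub>R (cl_vector x \<cdot>\<^sub>C q) = 0" "q \<noteq> 0" "x \<noteq> 0"
  shows "\<alpha> = 0 \<and> \<gamma> = 0"
proof -
  let ?Z = "\<alpha> *\<^sub>R q + \<gamma> *\<^sub>R (cl_vector x \<cdot>\<^sub>C q)"
  have "(\<alpha>\<^sup>2 + (\<gamma> * norm x)\<^sup>2) *\<^sub>R q = \<alpha> *\<^sub>R ?Z - \<gamma> *\<^sub>R (cl_vector x \<cdot>\<^sub>C ?Z)"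
    by (simp add: cl_mult_add_right cl_mult_scaleR_right cl_vector_sq algebra_simps power2_eq_square)
  also have "\<dots> = 0"
    by (simp add: assms cl_mult_zero_right)
  finally show ?thesis
    using assms by (simp add: sum_power2_eq_zero_iff)
qed

section \<open>Second derivatives of polynomials and solid harmonics\<close>

lemma bounded_linear_cl_mult_right: "bounded_linear (\<lambda>y. x \<cdot>\<^sub>C y)"
  by (simp add: linear_conv_bounded_linear[symmetric] linear_iff cl_mult_add_right cl_mult_scaleR_right)

lemma bounded_bilinear_cl_mult: "bounded_bilinear (\<cdot>\<^sub>C)"
  using bilinear_cl_mult bilinear_conv_bounded_bilinear by blast

text \<open>Induction over the construction of polynomials. Here \<open>f1 v\<close> is the
  derivative in direction \<open>v\<close> and \<open>f2 v w\<close> that of \<open>f1 v\<close> in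
  direction \<open>w\<close>; the symmetry of \<open>f2\<close> is read off from the sum and product
  rules.\<close>

lemma real_polynomial_second_derivative:
  assumes "real_polynomial_function (f :: 'a::real_normed_vector \<Rightarrow> real)"
  shows "\<exists>f1 f2. (\<forall>x. (f has_derivative (\<lambda>v. f1 v x)) (at x)) \<and>
    (\<forall>v x. (f1 v has_derivative (\<lambda>w. f2 v w x)) (at x)) \<and> (\<forall>v w x. f2 v w x = f2 w v x)"
  using assms
proof induction
  case (linear f)
  have "(f has_derivative f) (at x)" for x
    by (simp add: linear bounded_linear_imp_has_derivative)
  then show ?case
    by (intro exI[of _ "\<lambda>v x. f v"] exI[of _ "\<lambda>v w x. 0"]) auto
next
  case (const c)
  then show ?case
    by (intro exI[of _ "\<lambda>v x. 0"] exI[of _ "\<lambda>v w x. 0"]) auto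
next
  case (add f g)
  from add.IH(1) obtain f1 f2 where
    f: "\<forall>x. (f has_derivative (\<lambda>v. f1 v x)) (at x)"
       "\<forall>v x. (f1 v has_derivative (\<lambda>w. f2 v w x)) (at x)" "\<forall>v w x. f2 v w x = f2 w v x"
    by (elim exE conjE)
  from add.IH(2) obtain g1 g2 where
    g: "\<forall>x. (g has_derivative (\<lambda>v. g1 v x)) (at x)"
       "\<forall>v x. (g1 v has_derivative (\<lambda>w. g2 v w x)) (at x)" "\<forall>v w x. g2 v w x = g2 w v x"
    by (elim exE conjE)
  note f = f[rule_format] and g = g[rule_format]
  have 1: "((\<lambda>x. f x + g x) has_derivative (\<lambda>v. f1 v x + g1 v x)) (at x)" for x
    by (rule has_derivative_add[OF f(1) g(1)])
  have 2: "((\<lambda>x. f1 v x + g1 v x) has_derivative (\<lambda>w. f2 v w x + g2 v w x)) (at x)" for v x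
    by (rule has_derivative_add[OF f(2) g(2)])
  have 3: "f2 v w x + g2 v w x = f2 w v x + g2 w v x" for v w x
    using f(3)[of v w x] g(3)[of v w x] by simp
  show ?case
    by (rule exI[of _ "\<lambda>v x. f1 v x + g1 v x"], rule exI[of _ "\<lambda>v w x. f2 v w x + g2 v w x"])
       (intro conjI allI; rule 1 2 3)
next
  case (mult f g)
  from mult.IH(1) obtain f1 f2 where
    f: "\<forall>x. (f has_derivative (\<lambda>v. f1 v x)) (at x)"
       "\<forall>v x. (f1 v has_derivative (\<lambda>w. f2 v w x)) (at x)" "\<forall>v w x. f2 v w x = f2 w v x"
    by (elim exE conjE)
  from mult.IH(2) obtain g1 g2 where
    g: "\<forall>x. (g has_derivative (\<lambda>v. g1 v x)) (at x)"
       "\<forall>v x. (g1 v has_derivative (\<lambda>w. g2 v w x)) (at x)" "\<forall>v w x. g2 v w x = g2 w v x"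
    by (elim exE conjE)
  note f = f[rule_format] and g = g[rule_format]
  define h2 where "h2 v w x = f x * g2 v w x + f1 w x * g1 v x + (f1 v x * g1 w x + f2 v w x * g x)"
    for v w x
  have 1: "((\<lambda>x. f x * g x) has_derivative (\<lambda>v. f x * g1 v x + f1 v x * g x)) (at x)" for x
    by (rule has_derivative_mult[OF f(1) g(1)])
  have 2: "((\<lambda>x. f x * g1 v x + f1 v x * g x) has_derivative (\<lambda>w. h2 v w x)) (at x)" for v x
    unfolding h2_def
    by (rule has_derivative_add[OF has_derivative_mult[OF f(1) g(2)] has_derivative_mult[OF f(2) g(1)]])
  have 3: "h2 v w x = h2 w v x" for v w x
    using f(3)[of v w x] g(3)[of v w x] by (simp add: h2_def)
  show ?case
    by (rule exI[of _ "\<lambda>v x. f x * g1 v x + f1 v x * g x"], rule exI[of _ h2])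
       (intro conjI allI; rule 1 2 3)
qed

lemma polynomial_second_derivative:
  assumes "polynomial_function (f :: 'a::real_normed_vector \<Rightarrow> 'b::euclidean_space)"
  obtains f1 f2 where "\<And>x. (f has_derivative (\<lambda>v. f1 v x)) (at x)"
    "\<And>v x. (f1 v has_derivative (\<lambda>w. f2 v w x)) (at x)" "\<And>v w x. f2 v w x = f2 w v x"
proof -
  have "\<forall>b\<in>Basis. real_polynomial_function (\<lambda>x. f x \<bullet> b)"
    using assms by (simp add: polynomial_function_iff_Basis_inner)
  then have "\<forall>b\<in>Basis. \<exists>f1 f2. (\<forall>x. ((\<lambda>x. f x \<bullet> b) has_derivative (\<lambda>v. f1 v x)) (at x)) \<and>
    (\<forall>v x. (f1 v has_derivative (\<lambda>w. f2 v w x)) (at x)) \<and> (\<forall>v w x. f2 v w x = f2 w v x)"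
    using real_polynomial_second_derivative by blast
  then obtain f1 f2 where
    f: "\<And>b x. b \<in> Basis \<Longrightarrow> ((\<lambda>x. f x \<bullet> b) has_derivative (\<lambda>v. f1 b v x)) (at x)"
       "\<And>b v x. b \<in> Basis \<Longrightarrow> (f1 b v has_derivative (\<lambda>w. f2 b v w x)) (at x)"
       "\<And>b v w x. b \<in> Basis \<Longrightarrow> f2 b v w x = f2 b w v x"
    by metis
  show ?thesis
  proof
    show "(f has_derivative (\<lambda>v. \<Sum>b\<in>Basis. f1 b v x *\<^sub>R b)) (at x)" for x
    proof -
      have "((\<lambda>x. \<Sum>b\<in>Basis. (f x \<bullet> b) *\<^sub>R b) has_derivative (\<lambda>v. \<Sum>b\<in>Basis. f1 b v x *\<^sub>R b)) (at x)"
        by (intro has_derivative_sum has_derivative_scaleR_left f)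
      then show ?thesis
        by (simp add: euclidean_representation)
    qed
    show "((\<lambda>x. \<Sum>b\<in>Basis. f1 b v x *\<^sub>R b) has_derivative (\<lambda>w. \<Sum>b\<in>Basis. f2 b v w x *\<^sub>R b)) (at x)" for v x
      by (intro has_derivative_sum has_derivative_scaleR_left f)
    show "(\<Sum>b\<in>Basis. f2 b v w x *\<^sub>R b) = (\<Sum>b\<in>Basis. f2 b w v x *\<^sub>R b)" for v w x
      by (intro sum.cong refl) (metis f(3))
  qed
qed

text \<open>Homogeneity enters as Euler's relation, with \<open>Q1 v x\<close> the derivative at
  \<open>x\<close> in direction \<open>v\<close>: this is the form in which the cross term in the
  Laplacian of a product uses it.\<close>

definition solid_harmonic :: "nat \<Rightarrow> ('a::euclidean_space \<Rightarrow> 'b::real_normed_vector) \<Rightarrow> bool" where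
  "solid_harmonic n Q \<longleftrightarrow> (\<exists>Q1 Q2.
    (\<forall>x. (Q has_derivative (\<lambda>v. Q1 v x)) (at x)) \<and>
    (\<forall>v x. (Q1 v has_derivative (\<lambda>w. Q2 v w x)) (at x)) \<and>
    (\<forall>x. Q1 x x = real n *\<^sub>R Q x) \<and> (\<forall>x. (\<Sum>v\<in>Basis. Q2 v v x) = 0))"

lemma has_derivative_along_line:
  assumes "(F has_derivative F') (at p)"
  shows "((\<lambda>t. F (p + t *\<^sub>R v)) has_vector_derivative F' v) (at 0)"
proof -
  have "(F has_derivative F') (at (p + 0 *\<^sub>R v))"
    using assms by simp
  then have "((\<lambda>t. F (p + t *\<^sub>R v)) has_derivative (\<lambda>h. F' (h *\<^sub>R v))) (at 0)"
    by (rule has_derivative_compose[rotated]) (auto intro!: derivative_eq_intros)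
  then show ?thesis
    using linear_cmul[OF bounded_linear.linear[OF has_derivative_bounded_linear[OF assms]]]
    by (simp add: has_vector_derivative_def)
qed

lemma euler_homogeneous:
  assumes "(Q has_derivative Q') (at x)" "\<And>t. Q (t *\<^sub>R x) = t ^ n *\<^sub>R Q x"
  shows "Q' x = real n *\<^sub>R Q x"
proof -
  have "(Q has_derivative Q') (at (1 *\<^sub>R x))"
    using assms(1) by simp
  then have "((\<lambda>t. Q (t *\<^sub>R x)) has_derivative (\<lambda>h. Q' (h *\<^sub>R x))) (at 1)"
    by (rule has_derivative_compose[rotated]) (auto intro!: derivative_eq_intros)
  then have 1: "((\<lambda>t. Q (t *\<^sub>R x)) has_vector_derivative Q' x) (at 1)"
    using linear_cmul[OF bounded_linear.linear[OF has_derivative_bounded_linear[OF assms(1)]]]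
    by (simp add: has_vector_derivative_def)
  have 2: "((\<lambda>t. t ^ n *\<^sub>R Q x) has_vector_derivative real n *\<^sub>R Q x) (at 1)"
    by (auto intro!: derivative_eq_intros)
  show ?thesis
    using vector_derivative_unique_at[OF 1] 2 by (simp add: assms(2))
qed

lemma sum_Basis_vec:
  fixes F :: "'m::finite rvec \<Rightarrow> 'b::comm_monoid_add"
  shows "(\<Sum>v\<in>Basis. F v) = (\<Sum>j\<in>UNIV. F (axis j 1))"
proof -
  have Basis_eq: "(Basis :: 'm rvec set) = (\<lambda>j. axis j 1) ` UNIV"
    by (auto simp: Basis_vec_def)
  have "inj (\<lambda>j::'m. axis j (1::real))"
    by (auto simp: inj_on_def axis_eq_axis)
  then show ?thesis
    unfolding Basis_eq by (simp add: sum.reindex)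
qed

text \<open>Differentiating the Dirac equation of \<open>P\<close> once more and applying
  \<open>cl_gen_double_sum\<close> shows that \<open>P\<close> is harmonic. For the product with the
  vector variable, the additional terms of the Laplacian are twice the Dirac operator of
  \<open>P\<close> and vanish too, while the degree grows by one.\<close>

lemma hom_monogenic_poly_solid_harmonic:
  assumes "hom_monogenic_poly k P"
  shows "solid_harmonic k P" "solid_harmonic (Suc k) (\<lambda>x. cl_vector x \<cdot>\<^sub>C P x)"
proof -
  obtain f1 f2 where
    f: "\<And>x. (P has_derivative (\<lambda>v. f1 v x)) (at x)"
       "\<And>v x. (f1 v has_derivative (\<lambda>w. f2 v w x)) (at x)" "\<And>v w x. f2 v w x = f2 w v x"
    using assms polynomial_second_derivative unfolding hom_monogenic_poly_def by metis
  have hom: "P (t *\<^sub>R x) = t ^ k *\<^sub>R P x" for t x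
    using assms by (simp add: hom_monogenic_poly_def)
  have "partial_deriv v P x = f1 v x" for v x
    using has_derivative_along_line[OF f(1)] by (simp add: partial_deriv_def vector_derivative_at)
  then have dirac: "(\<Sum>j\<in>UNIV. cl_gen j \<cdot>\<^sub>C f1 (axis j 1) x) = 0" for x
    using assms by (simp add: hom_monogenic_poly_def dirac_def)
  have ddirac: "(\<Sum>j\<in>UNIV. cl_gen j \<cdot>\<^sub>C f2 (axis j 1) w x) = 0" for w x
  proof -
    have "((\<lambda>x. \<Sum>j\<in>UNIV. cl_gen j \<cdot>\<^sub>C f1 (axis j 1) x) has_derivative
        (\<lambda>w. \<Sum>j\<in>UNIV. cl_gen j \<cdot>\<^sub>C f2 (axis j 1) w x)) (at x)"
      by (intro has_derivative_sum bounded_linear.has_derivative[OF bounded_linear_cl_mult_right] f)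
    then have "((\<lambda>x. 0) has_derivative (\<lambda>w. \<Sum>j\<in>UNIV. cl_gen j \<cdot>\<^sub>C f2 (axis j 1) w x)) (at x)"
      by (simp only: dirac)
    then have "(\<lambda>w. \<Sum>j\<in>UNIV. cl_gen j \<cdot>\<^sub>C f2 (axis j 1) w x) = (\<lambda>w. 0)"
      using has_derivative_const has_derivative_unique by blast
    then show ?thesis
      by meson
  qed
  have harm: "(\<Sum>v\<in>Basis. f2 v v x) = 0" for x
  proof -
    have "- (\<Sum>v\<in>Basis. f2 v v x) = - (\<Sum>j\<in>UNIV. f2 (axis j 1) (axis j 1) x)"
      by (simp add: sum_Basis_vec)
    also have "\<dots> = (\<Sum>i\<in>UNIV. \<Sum>j\<in>UNIV. cl_gen i \<cdot>\<^sub>C (cl_gen j \<cdot>\<^sub>C f2 (axis j 1) (axis i 1) x))"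
      by (rule cl_gen_double_sum[symmetric]) (rule f(3))
    also have "\<dots> = (\<Sum>i\<in>UNIV. cl_gen i \<cdot>\<^sub>C (\<Sum>j\<in>UNIV. cl_gen j \<cdot>\<^sub>C f2 (axis j 1) (axis i 1) x))"
      by (simp add: cl_mult_sum_right)
    also have "\<dots> = 0"
      by (simp add: ddirac cl_mult_zero_right)
    finally show ?thesis
      by simp
  qed
  show "solid_harmonic k P"
    unfolding solid_harmonic_def
    by (rule exI[of _ f1], rule exI[of _ f2]) (use f harm euler_homogeneous[OF f(1) hom] in auto)
  let ?Q1 = "\<lambda>v x. cl_vector x \<cdot>\<^sub>C f1 v x + cl_vector v \<cdot>\<^sub>C P x"
  let ?Q2 = "\<lambda>v w x. (cl_vector x \<cdot>\<^sub>C f2 v w x + cl_vector w \<cdot>\<^sub>C f1 v x) + cl_vector v \<cdot>\<^sub>C f1 w x"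
  have vec: "(cl_vector has_derivative cl_vector) (at x)" for x :: "'a rvec"
    by (rule linear_imp_has_derivative[OF linear_cl_vector])
  have 1: "((\<lambda>x. cl_vector x \<cdot>\<^sub>C P x) has_derivative (\<lambda>v. ?Q1 v x)) (at x)" for x
    by (rule bounded_bilinear.FDERIV[OF bounded_bilinear_cl_mult vec f(1)])
  have 2: "(?Q1 v has_derivative (\<lambda>w. ?Q2 v w x)) (at x)" for v x
    by (intro has_derivative_add bounded_bilinear.FDERIV[OF bounded_bilinear_cl_mult vec f(2)]
        bounded_linear.has_derivative[OF bounded_linear_cl_mult_right] f(1))
  have 3: "?Q1 x x = real (Suc k) *\<^sub>R (cl_vector x \<cdot>\<^sub>C P x)" for x
    by (rule euler_homogeneous[OF 1])
       (simp add: hom linear_cmul[OF linear_cl_vector] cl_mult_scaleR_left cl_mult_scaleR_right)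
  have 4: "(\<Sum>v\<in>Basis. ?Q2 v v x) = 0" for x
  proof -
    have "(\<Sum>v\<in>Basis. cl_vector v \<cdot>\<^sub>C f1 v x) = 0"
      by (simp add: sum_Basis_vec cl_vector_axis dirac)
    moreover have "(\<Sum>v\<in>Basis. cl_vector x \<cdot>\<^sub>C f2 v v x) = 0"
      by (simp add: harm cl_mult_zero_right flip: cl_mult_sum_right)
    ultimately show ?thesis
      by (simp only: sum.distrib) simp
  qed
  show "solid_harmonic (Suc k) (\<lambda>x. cl_vector x \<cdot>\<^sub>C P x)"
    unfolding solid_harmonic_def
    by (rule exI[of _ ?Q1], rule exI[of _ ?Q2]) (use 1 2 3 4 in auto)
qed

section \<open>The Laplacian of radial multiples of solid harmonics\<close>

text \<open>\<open>partial_deriv\<close> has some value even where no derivative exists, so sums and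
  multiples are treated with genuine derivatives: \<open>D b\<close> is the first and
  \<open>E b\<close> the second one along \<open>b\<close>.\<close>

definition has_laplacian ::
  "('a::euclidean_space \<Rightarrow> 'b::real_normed_vector) \<Rightarrow> ('a \<Rightarrow> 'b) \<Rightarrow> 'a set \<Rightarrow> bool" where
  "has_laplacian F L W \<longleftrightarrow> (\<exists>D E. \<forall>p\<in>W. (\<forall>b\<in>Basis.
      ((\<lambda>t. F (p + t *\<^sub>R b)) has_vector_derivative D b p) (at 0) \<and>
      ((\<lambda>t. D b (p + t *\<^sub>R b)) has_vector_derivative E b p) (at 0)) \<and>
    L p = (\<Sum>b\<in>Basis. E b p))"

lemma partial_deriv_cong_open:
  assumes "open W" "p \<in> W" "\<And>q. q \<in> W \<Longrightarrow> G q = F q"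
    and "((\<lambda>t. F (p + t *\<^sub>R b)) has_vector_derivative D) (at 0)"
  shows "partial_deriv b G p = D"
proof -
  have "open ((\<lambda>t. p + t *\<^sub>R b) -` W)"
    by (intro open_vimage assms(1) continuous_intros)
  then have "((\<lambda>t. G (p + t *\<^sub>R b)) has_vector_derivative D) (at 0)"
    by (rule has_vector_derivative_transform_within_open[OF assms(4)]) (use assms in auto)
  then show ?thesis
    by (simp add: partial_deriv_def vector_derivative_at)
qed

text \<open>Locality is the point: in the iteration \<open>G\<close> is itself an iterated
  Laplacian, for which a formula is known on \<open>W\<close> only.\<close>

lemma laplacian_eq:
  assumes "has_laplacian F L W" "open W" "\<And>q. q \<in> W \<Longrightarrow> G q = F q" "p \<in> W"
  shows "laplacian G p = L p"
proof -
  obtain D E where D: "\<And>p b. p \<in> W \<Longrightarrow> b \<in> Basis \<Longrightarrow>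
      ((\<lambda>t. F (p + t *\<^sub>R b)) has_vector_derivative D b p) (at 0)"
    and E: "\<And>p b. p \<in> W \<Longrightarrow> b \<in> Basis \<Longrightarrow>
      ((\<lambda>t. D b (p + t *\<^sub>R b)) has_vector_derivative E b p) (at 0)"
    and L: "\<And>p. p \<in> W \<Longrightarrow> L p = (\<Sum>b\<in>Basis. E b p)"
    using assms(1) unfolding has_laplacian_def by metis
  have "partial_deriv b (partial_deriv b G) p = E b p" if b: "b \<in> Basis" for b
    by (rule partial_deriv_cong_open[OF assms(2,4) _ E[OF assms(4) b]])
       (rule partial_deriv_cong_open[OF assms(2) _ assms(3) D[OF _ b]])
  then show ?thesis
    by (simp add: laplacian_def L[OF assms(4)])
qed

lemma has_laplacian_add:
  assumes "has_laplacian F L W" "has_laplacian F' L' W"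
  shows "has_laplacian (\<lambda>p. F p + F' p) (\<lambda>p. L p + L' p) W"
proof -
  obtain D E where 1: "\<And>p b. p \<in> W \<Longrightarrow> b \<in> Basis \<Longrightarrow>
      ((\<lambda>t. F (p + t *\<^sub>R b)) has_vector_derivative D b p) (at 0)"
    "\<And>p b. p \<in> W \<Longrightarrow> b \<in> Basis \<Longrightarrow>
      ((\<lambda>t. D b (p + t *\<^sub>R b)) has_vector_derivative E b p) (at 0)"
    "\<And>p. p \<in> W \<Longrightarrow> L p = (\<Sum>b\<in>Basis. E b p)"
    using assms(1) unfolding has_laplacian_def by metis
  obtain D' E' where 2: "\<And>p b. p \<in> W \<Longrightarrow> b \<in> Basis \<Longrightarrow>
      ((\<lambda>t. F' (p + t *\<^sub>R b)) has_vector_derivative D' b p) (at 0)"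
    "\<And>p b. p \<in> W \<Longrightarrow> b \<in> Basis \<Longrightarrow>
      ((\<lambda>t. D' b (p + t *\<^sub>R b)) has_vector_derivative E' b p) (at 0)"
    "\<And>p. p \<in> W \<Longrightarrow> L' p = (\<Sum>b\<in>Basis. E' b p)"
    using assms(2) unfolding has_laplacian_def by metis
  show ?thesis
    unfolding has_laplacian_def
    by (rule exI[of _ "\<lambda>b p. D b p + D' b p"], rule exI[of _ "\<lambda>b p. E b p + E' b p"])
       (intro ballI conjI has_vector_derivative_add 1 2; simp add: 1 2 sum.distrib)
qed

lemma has_laplacian_scaleR:
  assumes "has_laplacian F L W"
  shows "has_laplacian (\<lambda>p. r *\<^sub>R F p) (\<lambda>p. r *\<^sub>R L p) W"
proof -
  obtain D E where 1: "\<And>p b. p \<in> W \<Longrightarrow> b \<in> Basis \<Longrightarrow>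
      ((\<lambda>t. F (p + t *\<^sub>R b)) has_vector_derivative D b p) (at 0)"
    "\<And>p b. p \<in> W \<Longrightarrow> b \<in> Basis \<Longrightarrow>
      ((\<lambda>t. D b (p + t *\<^sub>R b)) has_vector_derivative E b p) (at 0)"
    "\<And>p. p \<in> W \<Longrightarrow> L p = (\<Sum>b\<in>Basis. E b p)"
    using assms(1) unfolding has_laplacian_def by metis
  show ?thesis
    unfolding has_laplacian_def
    by (rule exI[of _ "\<lambda>b p. r *\<^sub>R D b p"], rule exI[of _ "\<lambda>b p. r *\<^sub>R E b p"])
       (intro ballI conjI bounded_linear.has_vector_derivative[OF bounded_linear_scaleR_right] 1;
        simp add: 1 scaleR_sum_right)
qed

text \<open>Since the radial derivative is written as \<open>norm x * f'\<close>, that is f' =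
  \<delta> f, the denominator of the gradient x / |x| of the norm cancels.\<close>

lemma radial_derivative_along_line:
  fixes x v :: "'a::euclidean_space"
  assumes "(f has_real_derivative norm x * f') (at (norm x))" "x \<noteq> 0"
  shows "((\<lambda>t. f (norm (x + t *\<^sub>R v))) has_real_derivative f' * (x \<bullet> v)) (at 0)"
proof -
  have "((\<lambda>t. norm (x + t *\<^sub>R v)) has_vector_derivative (x \<bullet> v) / norm x) (at 0)"
    using has_derivative_along_line[OF has_derivative_norm[OF assms(2)], of v]
    by (simp add: sgn_div_norm inner_commute divide_inverse mult.commute)
  then have "((\<lambda>t. norm (x + t *\<^sub>R v)) has_real_derivative (x \<bullet> v) / norm x) (at 0)"
    by (simp add: has_real_derivative_iff_has_vector_derivative)
  moreover have "(f has_real_derivative norm x * f') (at (norm (x + 0 *\<^sub>R v)))"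
    using assms(1) by simp
  ultimately show ?thesis
    using DERIV_chain2[of f "norm x * f'" "\<lambda>t. norm (x + t *\<^sub>R v)" 0 "(x \<bullet> v) / norm x" UNIV] assms(2)
    by simp
qed

lemma sum_Basis_prod:
  fixes f :: "'a::euclidean_space \<times> 'b::euclidean_space \<Rightarrow> 'c::comm_monoid_add"
  shows "(\<Sum>b\<in>Basis. f b) = (\<Sum>i\<in>Basis. f (i, 0)) + (\<Sum>i\<in>Basis. f (0, i))"
proof -
  have "inj_on (\<lambda>u. (u::'a, 0::'b)) Basis" "inj_on (\<lambda>u. (0::'a, u::'b)) Basis"
    by (auto intro!: inj_onI)
  then show ?thesis
    unfolding Basis_prod_def by (subst sum.union_disjoint) (auto simp: sum.reindex)
qed

text \<open>Here \<open>\<phi>1\<close> and \<open>\<phi>2\<close> are \<delta> \<phi> and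
  \<delta>^2 \<phi>, while \<open>\<psi>\<close> and \<open>\<eta>\<close> are the first two
  derivatives in \<open>x0\<close>. The spatial gradient of the radial factor is
  \<open>\<phi>1\<close> times x, so its spatial Laplacian is m \<open>\<phi>1\<close> + r^2
  \<open>\<phi>2\<close>. The cross term is 2 \<open>\<phi>1\<close> times the derivative of
  \<open>Q\<close> along x, which Euler's relation turns into 2 n \<open>\<phi>1\<close>
  \<open>Q\<close>.\<close>

lemma solid_harmonic_radial_laplacian:
  fixes Q :: "'m::finite rvec \<Rightarrow> 'b::real_normed_vector"
  assumes Q: "solid_harmonic n Q" and V: "V \<subseteq> UNIV \<times> {0<..}"
    and \<phi>: "\<And>x r. (x, r) \<in> V \<Longrightarrow> (\<phi> x has_real_derivative r * \<phi>1 x r) (at r)"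
    and \<phi>1: "\<And>x r. (x, r) \<in> V \<Longrightarrow> (\<phi>1 x has_real_derivative r * \<phi>2 x r) (at r)"
    and \<psi>: "\<And>x r. (x, r) \<in> V \<Longrightarrow> ((\<lambda>x. \<phi> x r) has_real_derivative \<psi> x r) (at x)"
    and \<eta>: "\<And>x r. (x, r) \<in> V \<Longrightarrow> ((\<lambda>x. \<psi> x r) has_real_derivative \<eta> x r) (at x)"
  shows "has_laplacian (\<lambda>(x0, x). \<phi> x0 (norm x) *\<^sub>R Q x)
    (\<lambda>(x0, x). (\<eta> x0 (norm x) + (norm x)\<^sup>2 * \<phi>2 x0 (norm x)
       + (real CARD('m) + 2 * real n) * \<phi>1 x0 (norm x)) *\<^sub>R Q x) (axial_region V)"
proof -
  obtain Q1 Q2 where Q12: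
    "\<forall>x. (Q has_derivative (\<lambda>v. Q1 v x)) (at x)"
    "\<forall>v x. (Q1 v has_derivative (\<lambda>w. Q2 v w x)) (at x)"
    "\<forall>x. Q1 x x = real n *\<^sub>R Q x" "\<forall>x. (\<Sum>v\<in>Basis. Q2 v v x) = 0"
    using Q unfolding solid_harmonic_def by (elim exE conjE)
  note Q1 = Q12(1)[rule_format] and Q2 = Q12(2)[rule_format]
    and euler = Q12(3)[rule_format] and harm = Q12(4)[rule_format]
  define D1 where "D1 v x0 x = (\<phi>1 x0 (norm x) * (x \<bullet> v)) *\<^sub>R Q x + \<phi> x0 (norm x) *\<^sub>R Q1 v x"
    for v x0 x
  define E1 where "E1 v x0 x =
      (\<phi>1 x0 (norm x) * (v \<bullet> v) + \<phi>2 x0 (norm x) * (x \<bullet> v) * (x \<bullet> v)) *\<^sub>R Q x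
      + (\<phi>1 x0 (norm x) * (x \<bullet> v)) *\<^sub>R Q1 v x + (\<phi>1 x0 (norm x) * (x \<bullet> v)) *\<^sub>R Q1 v x
      + \<phi> x0 (norm x) *\<^sub>R Q2 v v x" for v x0 x
  \<comment> \<open>The basis of the product space consists of \<open>(1, 0)\<close> and the vectors
    \<open>(0, v)\<close>; the test \<open>fst b = 0\<close> picks out the spatial
    directions.\<close>
  define D where "D b p = (if fst b = 0 then D1 (snd b) (fst p) (snd p)
      else \<psi> (fst p) (norm (snd p)) *\<^sub>R Q (snd p))" for b :: "'m paravector" and p
  define E where "E b p = (if fst b = 0 then E1 (snd b) (fst p) (snd p)
      else \<eta> (fst p) (norm (snd p)) *\<^sub>R Q (snd p))" for b :: "'m paravector" and p
  have Q1_sum: "(\<Sum>v\<in>Basis. (x \<bullet> v) *\<^sub>R Q1 v x) = real n *\<^sub>R Q x" for x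
  proof -
    have lin: "linear (\<lambda>v. Q1 v x)"
      using Q1 has_derivative_linear by blast
    have "real n *\<^sub>R Q x = Q1 (\<Sum>v\<in>Basis. (x \<bullet> v) *\<^sub>R v) x"
      by (simp add: euclidean_representation euler)
    also have "\<dots> = (\<Sum>v\<in>Basis. (x \<bullet> v) *\<^sub>R Q1 v x)"
      by (simp only: linear_sum[OF lin] linear_cmul[OF lin])
    finally show ?thesis by simp
  qed
  have E1_sum: "(\<Sum>v\<in>Basis. E1 v x0 x) = ((norm x)\<^sup>2 * \<phi>2 x0 (norm x)
       + (real CARD('m) + 2 * real n) * \<phi>1 x0 (norm x)) *\<^sub>R Q x" for x0 x
  proof -
    have a: "(\<Sum>v\<in>Basis. (\<phi>1 x0 (norm x) * (v \<bullet> v) + \<phi>2 x0 (norm x) * (x \<bullet> v) * (x \<bullet> v)))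
        = real CARD('m) * \<phi>1 x0 (norm x) + (norm x)\<^sup>2 * \<phi>2 x0 (norm x)"
      by (simp add: sum.distrib inner_same_Basis mult.assoc power2_norm_eq_inner
          euclidean_inner[of x x] flip: sum_distrib_left)
    have a': "(\<Sum>v\<in>Basis. (\<phi>1 x0 (norm x) * (v \<bullet> v) + \<phi>2 x0 (norm x) * (x \<bullet> v) * (x \<bullet> v)) *\<^sub>R Q x)
        = (real CARD('m) * \<phi>1 x0 (norm x) + (norm x)\<^sup>2 * \<phi>2 x0 (norm x)) *\<^sub>R Q x"
      by (simp only: a flip: scaleR_sum_left)
    have b: "(\<Sum>v\<in>Basis. (\<phi>1 x0 (norm x) * (x \<bullet> v)) *\<^sub>R Q1 v x)
        = \<phi>1 x0 (norm x) *\<^sub>R real n *\<^sub>R Q x"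
      unfolding Q1_sum[symmetric] scaleR_sum_right scaleR_scaleR ..
    have c: "(\<Sum>v\<in>Basis. \<phi> x0 (norm x) *\<^sub>R Q2 v v x) = 0"
      by (simp add: harm flip: scaleR_sum_right)
    show ?thesis
      unfolding E1_def sum.distrib a' b c
      by (simp flip: scaleR_add_left) (simp add: algebra_simps)
  qed
  show ?thesis
    unfolding has_laplacian_def
  proof (rule exI[of _ D], rule exI[of _ E], intro ballI conjI)
    fix p b :: "'m paravector"
    assume p: "p \<in> axial_region V" and b: "b \<in> Basis"
    obtain x0 x where px: "p = (x0, x)" by fastforce
    have V': "(x0, norm x) \<in> V" and x: "x \<noteq> 0"
      using p V by (auto simp: px axial_region_def)
    consider "b = (1, 0)" | v where "v \<in> Basis" "b = (0, v)"
      using b by (auto simp: Basis_prod_def)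
    note cases = this
    note line = has_derivative_along_line[OF Q1[of x]]
      radial_derivative_along_line[OF \<phi>[OF V'] x] radial_derivative_along_line[OF \<phi>1[OF V'] x]
    have shift: "((\<lambda>t. f (x0 + t)) has_real_derivative f') (at 0)"
      if "(f has_real_derivative f') (at x0)" for f f'
      using that DERIV_shift[of f f' 0 x0] by (simp add: add.commute)
    show "((\<lambda>t. (\<lambda>(x0, x). \<phi> x0 (norm x) *\<^sub>R Q x) (p + t *\<^sub>R b)) has_vector_derivative D b p) (at 0)"
      using cases
    proof cases
      case 1
      have "((\<lambda>t. \<phi> (x0 + t) (norm x) *\<^sub>R Q x) has_vector_derivative \<psi> x0 (norm x) *\<^sub>R Q x) (at 0)"
        using has_vector_derivative_scaleR[OF shift[OF \<psi>[OF V']] has_vector_derivative_const] by simp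
      then show ?thesis
        by (simp add: 1 px D_def)
    next
      case (2 v)
      have "((\<lambda>t. \<phi> x0 (norm (x + t *\<^sub>R v)) *\<^sub>R Q (x + t *\<^sub>R v)) has_vector_derivative D1 v x0 x) (at 0)"
        using has_vector_derivative_scaleR[OF line(2) line(1), of v] by (simp add: D1_def add.commute)
      then show ?thesis
        by (simp add: 2 px D_def)
    qed
    show "((\<lambda>t. D b (p + t *\<^sub>R b)) has_vector_derivative E b p) (at 0)"
      using cases
    proof cases
      case 1
      have "((\<lambda>t. \<psi> (x0 + t) (norm x) *\<^sub>R Q x) has_vector_derivative \<eta> x0 (norm x) *\<^sub>R Q x) (at 0)"
        using has_vector_derivative_scaleR[OF shift[OF \<eta>[OF V']] has_vector_derivative_const] by simp
      then show ?thesis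
        by (simp add: 1 px D_def E_def)
    next
      case (2 v)
      have "((\<lambda>t. (x + t *\<^sub>R v) \<bullet> v) has_real_derivative v \<bullet> v) (at 0)"
        by (auto intro!: derivative_eq_intros simp: inner_add_left)
      note has_vector_derivative_scaleR[OF DERIV_mult[OF line(3)[of v] this] line(1)[of v]]
        and has_vector_derivative_scaleR[OF line(2)[of v] has_derivative_along_line[OF Q2[of v x], of v]]
      from has_vector_derivative_add[OF this]
      have "((\<lambda>t. D1 v x0 (x + t *\<^sub>R v)) has_vector_derivative E1 v x0 x) (at 0)"
        by (simp add: D1_def E1_def algebra_simps flip: scaleR_add_left)
      then show ?thesis
        by (simp add: 2 px D_def E_def)
    qed
  next
    fix p :: "'m paravector"
    obtain x0 x where px: "p = (x0, x)" by fastforce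
    show "(\<lambda>(x0, x). (\<eta> x0 (norm x) + (norm x)\<^sup>2 * \<phi>2 x0 (norm x)
       + (real CARD('m) + 2 * real n) * \<phi>1 x0 (norm x)) *\<^sub>R Q x) p = (\<Sum>b\<in>Basis. E b p)"
      unfolding px sum_Basis_prod by (simp add: E_def E1_sum algebra_simps)
  qed
qed

section \<open>The chain of radial derivatives\<close>

text \<open>
  With \<open>\<delta> = r\<^sup>-\<^sup>1 \<partial>\<^sub>r\<close> the sequences are \<open>A s = \<delta>\<^sup>s u\<close> and \<open>C s = \<delta>\<^sup>s (v / r)\<close>. The two equations in the
  variable \<open>x\<close> say that \<open>(A s, r C s)\<close> solves the Vekua system with \<open>2 s\<close> in place of
  \<open>2 k + m - 1\<close>; for \<open>s = 0\<close> these are the Cauchy-Riemann equations of \<open>u + i v\<close>.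
\<close>

definition fueter_chain ::
  "(real \<times> real) set \<Rightarrow> (nat \<Rightarrow> real \<Rightarrow> real \<Rightarrow> real) \<Rightarrow> (nat \<Rightarrow> real \<Rightarrow> real \<Rightarrow> real) \<Rightarrow> bool" where
  "fueter_chain V A C \<longleftrightarrow> (\<forall>(x, r)\<in>V. \<forall>s.
    (A s x has_real_derivative r * A (Suc s) x r) (at r) \<and>
    (C s x has_real_derivative r * C (Suc s) x r) (at r) \<and>
    ((\<lambda>x. A s x r) has_real_derivative r\<^sup>2 * C (Suc s) x r + (2 * real s + 1) * C s x r) (at x) \<and>
    ((\<lambda>x. C s x r) has_real_derivative - A (Suc s) x r) (at x))"

lemma fueter_chainD:
  assumes "fueter_chain V A C" "(x, r) \<in> V"
  shows "(A s x has_real_derivative r * A (Suc s) x r) (at r)"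
    "(C s x has_real_derivative r * C (Suc s) x r) (at r)"
    "((\<lambda>x. A s x r) has_real_derivative r\<^sup>2 * C (Suc s) x r + (2 * real s + 1) * C s x r) (at x)"
    "((\<lambda>x. C s x r) has_real_derivative - A (Suc s) x r) (at x)"
  using assms by (auto simp: fueter_chain_def)

text \<open>
  A class of functions that is closed under \<open>\<partial>\<^sub>r\<close> and under division by \<open>r\<close>, so that \<open>\<delta>\<close> can be
  iterated on it.
\<close>

inductive holo_part :: "(complex \<Rightarrow> complex) \<Rightarrow> (real \<Rightarrow> real \<Rightarrow> real) \<Rightarrow> bool" for g where
  Re: "holo_part g (\<lambda>x y. Re (w * (deriv ^^ n) g (Complex x y)))"
| diff: "holo_part g f1 \<Longrightarrow> holo_part g f2 \<Longrightarrow> holo_part g (\<lambda>x y. f1 x y - f2 x y)"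
| div: "holo_part g f \<Longrightarrow> holo_part g (\<lambda>x y. f x y / y)"

text \<open>The weight \<open>w\<close> handles both parts at once: \<open>1\<close> selects the
  real part and \<open>-\<i>\<close> the imaginary part. Differentiation in \<open>y\<close> only
  multiplies the weight by \<open>\<i>\<close>.\<close>

lemma has_field_derivative_along_axes:
  assumes "(f has_field_derivative D) (at (Complex x y))"
  shows "((\<lambda>x. Re (w * f (Complex x y))) has_real_derivative Re (w * D)) (at x)"
    "((\<lambda>y. Re (w * f (Complex x y))) has_real_derivative Re (w * \<i> * D)) (at y)"
proof -
  have line: "((\<lambda>t. Re (w * f (p t))) has_real_derivative Re (w * (D * p'))) (at t)"
    if "(p has_vector_derivative p') (at t)" "p t = Complex x y" for p p' t
  proof -
    have "((f \<circ> p) has_vector_derivative p' * D) (at t)"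
      using field_vector_diff_chain_at[OF that(1), of f D] assms that(2) by simp
    then have "((\<lambda>t. Re (w * (f \<circ> p) t)) has_vector_derivative Re (w * (p' * D))) (at t)"
      by (intro bounded_linear.has_vector_derivative[OF bounded_linear_Re]
          bounded_linear.has_vector_derivative[OF bounded_linear_mult_right])
    then show ?thesis
      by (simp add: has_real_derivative_iff_has_vector_derivative mult.commute)
  qed
  have "((\<lambda>t. Complex t y) has_vector_derivative 1) (at x)"
    by (auto simp: Complex_eq intro!: derivative_eq_intros)
  from line[OF this] show "((\<lambda>x. Re (w * f (Complex x y))) has_real_derivative Re (w * D)) (at x)"
    by simp
  have "((\<lambda>t. Complex x t) has_vector_derivative \<i>) (at y)"
    by (auto simp: Complex_eq intro!: derivative_eq_intros)
  from line[OF this] show "((\<lambda>y. Re (w * f (Complex x y))) has_real_derivative Re (w * \<i> * D)) (at y)"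
    by (simp add: mult_ac)
qed

text \<open>The single function \<open>fxy\<close> is the value of both mixed derivatives, so that
  equations for the \<open>x\<close>-derivative can later be differentiated in \<open>y\<close>.
  Only \<open>fy\<close> has to stay in the class, because only \<delta> is iterated.\<close>

lemma holo_part_partials:
  assumes "holo_part g f" and g: "g holomorphic_on U" "open U" "U \<subseteq> {z. Im z > 0}"
  shows "\<exists>fx fy fxy. holo_part g fy \<and> (\<forall>x y. Complex x y \<in> U \<longrightarrow>
    ((\<lambda>x. f x y) has_real_derivative fx x y) (at x) \<and>
    (f x has_real_derivative fy x y) (at y) \<and>
    ((\<lambda>x. fy x y) has_real_derivative fxy x y) (at x) \<and>
    (fx x has_real_derivative fxy x y) (at y))"
  using assms(1)
proof induction
  case (Re w n)
  have D: "((deriv ^^ n) g has_field_derivative (deriv ^^ Suc n) g z) (at z)" if "z \<in> U" for n z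
    using holomorphic_higher_deriv[OF g(1,2), of n] g(2) that
    by (simp add: holomorphic_derivI)
  show ?case
    by (rule exI[of _ "\<lambda>x y. Re (w * (deriv ^^ Suc n) g (Complex x y))"],
        rule exI[of _ "\<lambda>x y. Re (w * \<i> * (deriv ^^ Suc n) g (Complex x y))"],
        rule exI[of _ "\<lambda>x y. Re (w * \<i> * (deriv ^^ Suc (Suc n)) g (Complex x y))"])
       (intro conjI allI impI holo_part.Re has_field_derivative_along_axes D)
next
  case (diff f1 f2)
  from diff.IH(1) obtain f1x f1y f1xy where 1: "holo_part g f1y" "\<forall>x y. Complex x y \<in> U \<longrightarrow>
    ((\<lambda>x. f1 x y) has_real_derivative f1x x y) (at x) \<and>
    (f1 x has_real_derivative f1y x y) (at y) \<and>
    ((\<lambda>x. f1y x y) has_real_derivative f1xy x y) (at x) \<and>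
    (f1x x has_real_derivative f1xy x y) (at y)"
    by (elim exE conjE)
  from diff.IH(2) obtain f2x f2y f2xy where 2: "holo_part g f2y" "\<forall>x y. Complex x y \<in> U \<longrightarrow>
    ((\<lambda>x. f2 x y) has_real_derivative f2x x y) (at x) \<and>
    (f2 x has_real_derivative f2y x y) (at y) \<and>
    ((\<lambda>x. f2y x y) has_real_derivative f2xy x y) (at x) \<and>
    (f2x x has_real_derivative f2xy x y) (at y)"
    by (elim exE conjE)
  show ?case
    by (rule exI[of _ "\<lambda>x y. f1x x y - f2x x y"], rule exI[of _ "\<lambda>x y. f1y x y - f2y x y"],
        rule exI[of _ "\<lambda>x y. f1xy x y - f2xy x y"])
       (intro conjI allI impI holo_part.diff 1(1) 2(1) DERIV_diff; simp add: 1(2) 2(2))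
next
  case (div f)
  from div.IH obtain fx fy fxy where 1: "holo_part g fy" and 2: "\<forall>x y. Complex x y \<in> U \<longrightarrow>
    ((\<lambda>x. f x y) has_real_derivative fx x y) (at x) \<and>
    (f x has_real_derivative fy x y) (at y) \<and>
    ((\<lambda>x. fy x y) has_real_derivative fxy x y) (at x) \<and>
    (fx x has_real_derivative fxy x y) (at y)"
    by (elim exE conjE)
  have quotient: "((\<lambda>y. h y / y) has_real_derivative h' / y - h y / y / y) (at y)"
    if "(h has_real_derivative h') (at y)" "Complex x y \<in> U" for h h' x y
  proof -
    have "y \<noteq> 0"
      using that(2) g(3) by auto
    then show ?thesis
      by (auto intro!: derivative_eq_intros that(1) simp: divide_simps)
  qed
  show ?case
    by (rule exI[of _ "\<lambda>x y. fx x y / y"], rule exI[of _ "\<lambda>x y. fy x y / y - f x y / y / y"],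
        rule exI[of _ "\<lambda>x y. fxy x y / y - fx x y / y / y"])
       (intro conjI allI impI holo_part.diff holo_part.div div.hyps 1 DERIV_diff DERIV_cdivide quotient;
        simp add: 2)
qed

text \<open>The operator \<delta> is iterated on Re g and on Im g / y. The Cauchy-Riemann equations
  are the two equations in \<open>x\<close> at index 0, and applying \<delta> to them gives the
  equations at the next index.\<close>

lemma holomorphic_fueter_chain:
  assumes g: "g holomorphic_on U" "open U" "U \<subseteq> {z. Im z > 0}"
  obtains A C where "fueter_chain {(x, y). Complex x y \<in> U} A C"
    "\<And>x y. A 0 x y = Re (g (Complex x y))" "\<And>x y. C 0 x y = Im (g (Complex x y)) / y"
proof -
  \<comment> \<open>\<open>R f f'\<close> expresses f' = \<delta> f on \<open>U\<close>, together
    with the fact that \<delta> commutes with the derivative in x; \<open>fx\<close> and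
    \<open>fx'\<close> are the derivatives of \<open>f\<close> and \<open>f'\<close> in x.\<close>
  define R where "R f f' \<longleftrightarrow> (\<exists>fx fx'. \<forall>x y. Complex x y \<in> U \<longrightarrow>
      (f x has_real_derivative y * f' x y) (at y) \<and>
      ((\<lambda>x. f x y) has_real_derivative fx x y) (at x) \<and>
      ((\<lambda>x. f' x y) has_real_derivative fx' x y) (at x) \<and>
      (fx x has_real_derivative y * fx' x y) (at y))" for f f' :: "real \<Rightarrow> real \<Rightarrow> real"
  have step: "\<exists>f'. holo_part g f' \<and> R f f'" if f: "holo_part g f" for f
  proof -
    from holo_part_partials[OF f g] obtain fx fy fxy where 1: "holo_part g fy" and
      2: "\<forall>x y. Complex x y \<in> U \<longrightarrow>
        ((\<lambda>x. f x y) has_real_derivative fx x y) (at x) \<and>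
        (f x has_real_derivative fy x y) (at y) \<and>
        ((\<lambda>x. fy x y) has_real_derivative fxy x y) (at x) \<and>
        (fx x has_real_derivative fxy x y) (at y)"
      by (elim exE conjE)
    have "y \<noteq> 0" if "Complex x y \<in> U" for x y
      using that g(3) by auto
    then have "R f (\<lambda>x y. fy x y / y)"
      unfolding R_def
      by (intro exI[of _ fx] exI[of _ "\<lambda>x y. fxy x y / y"])
         (simp add: 2 DERIV_cdivide)
    then show ?thesis
      using holo_part.div[OF 1] by blast
  qed
  have seq: "\<exists>F. F 0 = f \<and> (\<forall>s. R (F s) (F (Suc s)))" if f: "holo_part g f" for f
  proof -
    \<comment> \<open>A successor is known only to exist, so the iterates come from dependent
      choice; the clause for \<open>s = 0\<close> fixes the start.\<close>
    have "\<exists>F. \<forall>s. (holo_part g (F s) \<and> (s = 0 \<longrightarrow> F s = f)) \<and> R (F s) (F (Suc s))"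
      by (rule dependent_nat_choice) (use f step in auto)
    then show ?thesis
      by blast
  qed
  from seq[OF holo_part.Re[of g 1 0]] obtain A where
    A0: "A 0 = (\<lambda>x y. Re (1 * (deriv ^^ 0) g (Complex x y)))" and A: "\<forall>s. R (A s) (A (Suc s))"
    by blast
  from seq[OF holo_part.div[OF holo_part.Re[of g "-\<i>" 0]]] obtain C where
    C0: "C 0 = (\<lambda>x y. Re (-\<i> * (deriv ^^ 0) g (Complex x y)) / y)" and C: "\<forall>s. R (C s) (C (Suc s))"
    by blast
  \<comment> \<open>Each link of the sequence supplies its own pair of x-derivatives. Uniqueness of
    derivatives identifies \<open>fx' s\<close> with \<open>fx (Suc s)\<close> on \<open>U\<close>,
    so one sequence \<open>Fx\<close> serves all links.\<close>
  have partials: "\<exists>Fx. \<forall>s x y. Complex x y \<in> U \<longrightarrow>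
      (F s x has_real_derivative y * F (Suc s) x y) (at y) \<and>
      ((\<lambda>x. F s x y) has_real_derivative Fx s x y) (at x) \<and>
      (Fx s x has_real_derivative y * Fx (Suc s) x y) (at y)"
    if F: "\<forall>s. R (F s) (F (Suc s))" for F
  proof -
    obtain fx fx' where f: "\<And>s x y. Complex x y \<in> U \<Longrightarrow>
      (F s x has_real_derivative y * F (Suc s) x y) (at y) \<and>
      ((\<lambda>x. F s x y) has_real_derivative fx s x y) (at x) \<and>
      ((\<lambda>x. F (Suc s) x y) has_real_derivative fx' s x y) (at x) \<and>
      (fx s x has_real_derivative y * fx' s x y) (at y)"
      using F unfolding R_def by metis
    then have "fx' s x y = fx (Suc s) x y" if "Complex x y \<in> U" for s x y
      using that DERIV_unique by blast
    with f show ?thesis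
      by (intro exI[of _ fx]) metis
  qed
  obtain Ax where Ax: "\<And>s x y. Complex x y \<in> U \<Longrightarrow>
      (A s x has_real_derivative y * A (Suc s) x y) (at y) \<and>
      ((\<lambda>x. A s x y) has_real_derivative Ax s x y) (at x) \<and>
      (Ax s x has_real_derivative y * Ax (Suc s) x y) (at y)"
    using partials[OF A] by blast
  obtain Cx where Cx: "\<And>s x y. Complex x y \<in> U \<Longrightarrow>
      (C s x has_real_derivative y * C (Suc s) x y) (at y) \<and>
      ((\<lambda>x. C s x y) has_real_derivative Cx s x y) (at x) \<and>
      (Cx s x has_real_derivative y * Cx (Suc s) x y) (at y)"
    using partials[OF C] by blast
  have pos: "y \<noteq> 0" if "Complex x y \<in> U" for x y
    using that g(3) by auto
  \<comment> \<open>An identity valid on \<open>U\<close> may be differentiated in \<open>y\<close>,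
    since vertical sections of \<open>U\<close> are open.\<close>
  have local: "D = D'" if "Complex x y \<in> U" "(f has_real_derivative D) (at y)"
    "(f' has_real_derivative D') (at y)" "\<And>y. Complex x y \<in> U \<Longrightarrow> f y = f' y" for f f' D D' x y
  proof -
    have "open ((\<lambda>y. Complex x y) -` U)"
      unfolding Complex_eq by (intro open_vimage g(2) continuous_intros)
    then have "(f' has_real_derivative D) (at y)"
      by (rule has_field_derivative_transform_within_open[OF that(2)]) (use that in auto)
    with that(3) show ?thesis
      using DERIV_unique by blast
  qed
  have x_eqs: "(\<forall>x y. Complex x y \<in> U \<longrightarrow> Ax s x y = y\<^sup>2 * C (Suc s) x y + (2 * real s + 1) * C s x y) \<and>
    (\<forall>x y. Complex x y \<in> U \<longrightarrow> Cx s x y = - A (Suc s) x y)" for s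
  proof (induction s)
    case 0
    have "Ax 0 x y = y\<^sup>2 * C (Suc 0) x y + C 0 x y \<and> Cx 0 x y = - A (Suc 0) x y"
      if z: "Complex x y \<in> U" for x y
    proof -
      have g': "(g has_field_derivative deriv g (Complex x y)) (at (Complex x y))"
        using g(1,2) z holomorphic_derivI by blast
      note re = has_field_derivative_along_axes[OF g', of 1] and
        im = has_field_derivative_along_axes[OF g', of "-\<i>"]
      \<comment> \<open>The imaginary part is \<open>y * C 0 x y\<close>; the product rule adds the
        term \<open>C 0 x y\<close>, which is the coefficient 2 s + 1 at s = 0.\<close>
      have im': "((\<lambda>y. y * C 0 x y) has_real_derivative y * (y * C (Suc 0) x y) + 1 * C 0 x y) (at y)"
        using DERIV_mult[OF DERIV_ident conjunct1[OF Cx[OF z, of 0]]] by (simp add: mult_ac add_ac)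
      have "Re (deriv g (Complex x y)) = y * (y * C (Suc 0) x y) + 1 * C 0 x y"
        by (rule local[OF z _ im', of "\<lambda>y. Re (-\<i> * g (Complex x y))"])
           (use im(2) pos in \<open>auto simp: C0\<close>)
      moreover have "Ax 0 x y = Re (deriv g (Complex x y))"
        using re(1) Ax[OF z, of 0] DERIV_unique by (fastforce simp: A0)
      moreover have "y * A (Suc 0) x y = - Im (deriv g (Complex x y))"
        using re(2) Ax[OF z, of 0] DERIV_unique by (fastforce simp: A0)
      moreover have "Cx 0 x y = Im (deriv g (Complex x y)) / y"
        using DERIV_cdivide[OF im(1), of y] Cx[OF z, of 0] DERIV_unique by (fastforce simp: C0)
      ultimately have "y * Cx 0 x y = y * (- A (Suc 0) x y)" "Ax 0 x y = y\<^sup>2 * C (Suc 0) x y + C 0 x y"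
        using pos[OF z] by (simp_all add: power2_eq_square)
      then show ?thesis
        using pos[OF z] by (metis mult_left_cancel)
    qed
    then show ?case
      by simp
  next
    \<comment> \<open>Both equations at \<open>s\<close> are differentiated in \<open>y\<close> and
      divided by \<open>y\<close>. The derivative of \<open>y^2\<close> contributes 2, raising the
      coefficient from 2 s + 1 to 2 s + 3.\<close>
    case (Suc s)
    have "Ax (Suc s) x y = y\<^sup>2 * C (Suc (Suc s)) x y + (2 * real (Suc s) + 1) * C (Suc s) x y \<and>
        Cx (Suc s) x y = - A (Suc (Suc s)) x y" if z: "Complex x y \<in> U" for x y
    proof -
      have c: "(C s x has_real_derivative y * C (Suc s) x y) (at y)" for s
        using Cx[OF z] by blast
      have "((\<lambda>y. y\<^sup>2 * C (Suc s) x y + (2 * real s + 1) * C s x y) has_real_derivative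
          y * (y\<^sup>2 * C (Suc (Suc s)) x y + (2 * real (Suc s) + 1) * C (Suc s) x y)) (at y)"
        by (auto intro!: derivative_eq_intros c simp: algebra_simps power2_eq_square)
      from local[OF z _ this, of "Ax s x" "y * Ax (Suc s) x y"]
      have 1: "y * Ax (Suc s) x y
          = y * (y\<^sup>2 * C (Suc (Suc s)) x y + (2 * real (Suc s) + 1) * C (Suc s) x y)"
        using Ax[OF z] Suc by blast
      have "((\<lambda>y. - A (Suc s) x y) has_real_derivative - (y * A (Suc (Suc s)) x y)) (at y)"
        using Ax[OF z] by (intro DERIV_minus) blast
      from local[OF z _ this, of "Cx s x" "y * Cx (Suc s) x y"]
      have "y * Cx (Suc s) x y = - (y * A (Suc (Suc s)) x y)"
        using Cx[OF z] Suc by blast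
      then have "y * Cx (Suc s) x y = y * (- A (Suc (Suc s)) x y)"
        by simp
      with 1 show ?thesis
        using pos[OF z] by (metis mult_left_cancel)
    qed
    then show ?case
      by blast
  qed
  show ?thesis
  proof
    show "fueter_chain {(x, y). Complex x y \<in> U} A C"
      unfolding fueter_chain_def using Ax Cx x_eqs by auto
    show "A 0 x y = Re (g (Complex x y))" "C 0 x y = Im (g (Complex x y)) / y" for x y
      by (simp_all add: A0 C0)
  qed
qed

section \<open>Iterated Laplacians and the Fueter mapping\<close>

lemma prod_eq_double_fact: "(\<Prod>i<n. 2 * (real n - real i)) = real (double_fact (2 * n))"
proof (induction n)
  case (Suc n)
  have "(\<Prod>i<Suc n. 2 * (real (Suc n) - real i)) = 2 * real (Suc n) * (\<Prod>i<n. 2 * (real n - real i))"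
    by (subst prod.lessThan_Suc_shift) simp
  with Suc show ?case
    by (simp add: algebra_simps)
qed simp

lemma open_axial_region: "open V \<Longrightarrow> open (axial_region V)"
proof -
  assume "open V"
  then have "open ((\<lambda>p. (fst p, norm (snd p))) -` V :: 'a paravector set)"
    by (intro open_vimage continuous_intros)
  moreover have "axial_region V = ((\<lambda>p. (fst p, norm (snd p))) -` V :: 'a paravector set)"
    by (auto simp: axial_region_def)
  ultimately show ?thesis
    by simp
qed

lemma axial_fun_eq:
  assumes "x \<noteq> 0"
  shows "axial_fun A B P (x0, x)
    = A (x0, norm x) *\<^sub>R P x + (B (x0, norm x) / norm x) *\<^sub>R (cl_vector x \<cdot>\<^sub>C P x)"
  by (simp add: axial_fun_def cl_mult_add_left cl_mult_scalar_left cl_mult_scaleR_left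
      linear_cmul[OF linear_cl_vector] divide_inverse)

text \<open>By the chain equations the second derivative of \<open>A s\<close> in x is -r^2
  \<open>A (s + 2)\<close> - (2 s + 1) \<open>A (s + 1)\<close>. The term with r^2 cancels against
  the radial one, leaving the factor m + 2 k - 2 s - 1 = 2 (N - s). For \<open>C s\<close> both the
  degree and the chain coefficient are shifted, k + 1 and 2 s + 3, and the same factor
  results.\<close>

lemma iterated_laplacian_fueter_chain:
  fixes P :: "'m rvec \<Rightarrow> 'm::{finite,linorder} clifford"
  assumes P: "hom_monogenic_poly k P" and N: "2 * N + 1 = 2 * k + CARD('m)"
    and V: "open V" "V \<subseteq> UNIV \<times> {0<..}" and chain: "fueter_chain V A C"
    and F: "\<And>x0 x. (x0, norm x) \<in> V \<Longrightarrow>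
      F (x0, x) = A 0 x0 (norm x) *\<^sub>R P x + C 0 x0 (norm x) *\<^sub>R (cl_vector x \<cdot>\<^sub>C P x)"
    and p: "(x0, norm x) \<in> V"
  shows "(laplacian ^^ s) F (x0, x) = (\<Prod>i<s. 2 * (real N - real i)) *\<^sub>R
    (A s x0 (norm x) *\<^sub>R P x + C s x0 (norm x) *\<^sub>R (cl_vector x \<cdot>\<^sub>C P x))"
  using p
proof (induction s arbitrary: x0 x)
  case 0
  then show ?case
    by (simp add: F)
next
  case (Suc s)
  let ?c = "\<lambda>s. \<Prod>i<s. 2 * (real N - real i)"
  let ?\<eta>A = "\<lambda>x r. r\<^sup>2 * - A (Suc (Suc s)) x r + (2 * real s + 1) * - A (Suc s) x r"
  let ?\<eta>C = "\<lambda>x r. - (r\<^sup>2 * C (Suc (Suc s)) x r + (2 * real (Suc s) + 1) * C (Suc s) x r)"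
  note D = fueter_chainD[OF chain]
  have N': "real CARD('m) = 2 * real N + 1 - 2 * real k"
    using arg_cong[OF N, of real] by simp
  have \<eta>A: "((\<lambda>x. r\<^sup>2 * C (Suc s) x r + (2 * real s + 1) * C s x r) has_real_derivative ?\<eta>A x r) (at x)"
    if "(x, r) \<in> V" for x r
    by (intro DERIV_add DERIV_cmult D(4) that)
  have 1: "has_laplacian (\<lambda>(x0, x). A s x0 (norm x) *\<^sub>R P x)
    (\<lambda>(x0, x). (?\<eta>A x0 (norm x) + (norm x)\<^sup>2 * A (Suc (Suc s)) x0 (norm x)
       + (real CARD('m) + 2 * real k) * A (Suc s) x0 (norm x)) *\<^sub>R P x) (axial_region V)"
    by (rule solid_harmonic_radial_laplacian[OF hom_monogenic_poly_solid_harmonic(1)[OF P] V(2)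
          D(1) D(1) D(3) \<eta>A])
  have 2: "has_laplacian (\<lambda>(x0, x). C s x0 (norm x) *\<^sub>R (cl_vector x \<cdot>\<^sub>C P x))
    (\<lambda>(x0, x). (?\<eta>C x0 (norm x) + (norm x)\<^sup>2 * C (Suc (Suc s)) x0 (norm x)
       + (real CARD('m) + 2 * real (Suc k)) * C (Suc s) x0 (norm x)) *\<^sub>R (cl_vector x \<cdot>\<^sub>C P x))
    (axial_region V)"
    by (rule solid_harmonic_radial_laplacian[OF hom_monogenic_poly_solid_harmonic(2)[OF P] V(2)
          D(2) D(2) D(4) DERIV_minus[OF D(3)]])
  have x: "(x0, x) \<in> axial_region V"
    using Suc.prems by (simp add: axial_region_def)
  have "(laplacian ^^ Suc s) F (x0, x) = laplacian ((laplacian ^^ s) F) (x0, x)"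
    by simp
  also have "\<dots> = ?c s *\<^sub>R (2 * (real N - real s)) *\<^sub>R
      (A (Suc s) x0 (norm x) *\<^sub>R P x + C (Suc s) x0 (norm x) *\<^sub>R (cl_vector x \<cdot>\<^sub>C P x))"
    by (subst laplacian_eq[OF has_laplacian_scaleR[OF has_laplacian_add[OF 1 2], of "?c s"]
          open_axial_region[OF V(1)] _ x])
       (auto simp: Suc.IH axial_region_def N' algebra_simps)
  finally show ?case
    by simp
qed

lemma fueter_map_eq:
  fixes P :: "'m rvec \<Rightarrow> 'm::{finite,linorder} clifford"
  assumes P: "hom_monogenic_poly k P" and m: "odd CARD('m)" and N: "N = k + (CARD('m) - 1) div 2"
    and U: "open U" "U \<subseteq> {z. Im z > 0}"
    and chain: "fueter_chain {(x, y). Complex x y \<in> U} A C"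
    and A0: "\<And>x y. A 0 x y = Re (g (Complex x y))"
    and C0: "\<And>x y. C 0 x y = Im (g (Complex x y)) / y"
    and p: "Complex x0 (norm x) \<in> U"
  shows "fueter_map g k P (x0, x) = real (double_fact (2 * N)) *\<^sub>R
    (A N x0 (norm x) *\<^sub>R P x + C N x0 (norm x) *\<^sub>R (cl_vector x \<cdot>\<^sub>C P x))"
proof -
  let ?V = "{(x, y). Complex x y \<in> U}"
  have "?V = (\<lambda>(x, y). Complex x y) -` U"
    by auto
  moreover have "open ((\<lambda>(x, y). Complex x y) -` U)"
    unfolding Complex_eq case_prod_unfold by (intro open_vimage U(1) continuous_intros)
  ultimately have V: "open ?V" "?V \<subseteq> UNIV \<times> {0<..}"
    using U(2) by auto
  have "2 * N + 1 = 2 * k + CARD('m)"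
    using m N by (auto elim!: oddE)
  then show ?thesis
    unfolding fueter_map_def N[symmetric] prod_eq_double_fact[symmetric]
    by (rule iterated_laplacian_fueter_chain[OF P _ V chain])
       (use V(2) p in \<open>auto simp: axial_fun_eq A0 C0\<close>)
qed

section \<open>Taylor expansion in the squared radius\<close>

lemma double_fact_even_pos: "double_fact (2 * n) > 0"
  by (induction n) auto

text \<open>Taylor's formula with integral remainder in the variable r^2, where \<delta> is twice
  the ordinary derivative; hence (2 i)!! = 2^i i! replaces i!. The Taylor polynomial with moving
  centre \<open>t\<close> has a telescoping derivative, which is integrated from \<open>c\<close> to
  \<open>r\<close>.\<close>

lemma radial_taylor:
  fixes f :: "nat \<Rightarrow> real \<Rightarrow> real"
  assumes "c \<le> r" "0 < n"
    and f: "\<And>i t. i < n \<Longrightarrow> t \<in> {c..r} \<Longrightarrow>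
      (f i has_real_derivative t * f (Suc i) t) (at t within {c..r})"
  shows "((\<lambda>t. t * (r\<^sup>2 - t\<^sup>2) ^ (n - 1) * f n t / double_fact (2 * (n - 1))) has_integral
    f 0 r - (\<Sum>i<n. f i c * (r\<^sup>2 - c\<^sup>2) ^ i / double_fact (2 * i))) {c..r}"
proof -
  let ?G = "\<lambda>t. \<Sum>i<n. f i t * (r\<^sup>2 - t\<^sup>2) ^ i / double_fact (2 * i)"
  \<comment> \<open>The derivative of the \<open>i\<close>-th Taylor term is
    \<open>T t (Suc i) - T t i\<close>. The value 0 at \<open>i = 0\<close> accounts for the term
    that has no power to differentiate.\<close>
  define T where "T t i = (if i = 0 then 0
    else t * (r\<^sup>2 - t\<^sup>2) ^ (i - 1) * f i t / double_fact (2 * (i - 1)))" for t i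
  have "(?G has_real_derivative T t n) (at t within {c..r})" if t: "t \<in> {c..r}" for t
  proof -
    have "((\<lambda>t. f i t * (r\<^sup>2 - t\<^sup>2) ^ i / double_fact (2 * i)) has_real_derivative T t (Suc i) - T t i)
        (at t within {c..r})" if "i < n" for i
    proof (cases i)
      case 0
      then show ?thesis
        using f[OF \<open>i < n\<close> t] by (simp add: T_def)
    next
      case (Suc l)
      have df: "real (double_fact (2 * i)) = 2 * real i * double_fact (2 * l)"
        by (simp add: Suc algebra_simps)
      have pos: "real (double_fact (2 * l)) \<noteq> 0"
        using double_fact_even_pos[of l] by simp
      have "((\<lambda>t. f i t * (r\<^sup>2 - t\<^sup>2) ^ i / double_fact (2 * i)) has_real_derivative
          (f i t * (real i * - (2 * t) * (r\<^sup>2 - t\<^sup>2) ^ l) + t * f (Suc i) t * (r\<^sup>2 - t\<^sup>2) ^ i)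
            / double_fact (2 * i)) (at t within {c..r})"
        by (rule DERIV_cdivide, (rule derivative_eq_intros f[OF \<open>i < n\<close> t] refl)+) (simp add: Suc)
      moreover have "(f i t * (real i * - (2 * t) * (r\<^sup>2 - t\<^sup>2) ^ l) + t * f (Suc i) t * (r\<^sup>2 - t\<^sup>2) ^ i)
            / double_fact (2 * i) = T t (Suc i) - T t i"
      proof -
        have nz: "real i \<noteq> 0"
          by (simp add: Suc)
        have cancel: "(a * (L * - (2 * t) * q) + X) / (2 * L * d) = X / (2 * L * d) - t * q * a / d"
          if "L \<noteq> 0" "d \<noteq> 0" for a L q X d :: real
          using that by (simp add: field_simps)
        have "T t (Suc i) = t * f (Suc i) t * (r\<^sup>2 - t\<^sup>2) ^ i / (2 * real i * double_fact (2 * l))"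
          unfolding df[symmetric] by (simp add: T_def)
        moreover have "T t i = t * (r\<^sup>2 - t\<^sup>2) ^ l * f i t / double_fact (2 * l)"
          by (simp add: T_def Suc)
        ultimately show ?thesis
          using cancel[OF nz pos] by (simp only: df)
      qed
      ultimately show ?thesis
        by simp
    qed
    then have "(?G has_real_derivative (\<Sum>i<n. T t (Suc i) - T t i)) (at t within {c..r})"
      by (intro DERIV_sum) simp
    moreover have "(\<Sum>i<n. T t (Suc i) - T t i) = T t n"
      by (simp add: sum_lessThan_telescope) (simp add: T_def)
    ultimately show ?thesis
      by simp
  qed
  then have "(T' has_integral ?G r - ?G c) {c..r}" if "T' = (\<lambda>t. T t n)" for T'
    using assms(1) that
    by (intro fundamental_theorem_of_calculus) (auto simp: has_real_derivative_iff_has_vector_derivative)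
  \<comment> \<open>With the centre at \<open>r\<close> all powers with positive exponent
    vanish.\<close>
  moreover have "?G r = f 0 r"
  proof -
    have "?G r = (\<Sum>i<n. if i = 0 then f 0 r else 0)"
      by (intro sum.cong) auto
    then show ?thesis
      using assms(2) by simp
  qed
  ultimately show ?thesis
    using assms(2) by (simp add: T_def)
qed

text \<open>The coefficient of \<open>r ^ (2 * j)\<close> in \<open>\<Sum>i<N. y i * (r\<^sup>2 - c\<^sup>2) ^ i / (2 i)!!\<close>.\<close>

definition radial_coeff :: "nat \<Rightarrow> real \<Rightarrow> (nat \<Rightarrow> real) \<Rightarrow> nat \<Rightarrow> real" where
  "radial_coeff N c y j = (\<Sum>i<N. y i * (real (i choose j) * (- c\<^sup>2) ^ (i - j) / double_fact (2 * i)))"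

lemma sum_radial_coeff:
  "(\<Sum>i<N. y i * (r\<^sup>2 - c\<^sup>2) ^ i / double_fact (2 * i)) = (\<Sum>j<N. radial_coeff N c y j * r ^ (2 * j))"
proof -
  have binom: "(r\<^sup>2 - c\<^sup>2) ^ i = (\<Sum>j<N. real (i choose j) * (- c\<^sup>2) ^ (i - j) * r ^ (2 * j))"
    if "i < N" for i
  proof -
    have "(r\<^sup>2 - c\<^sup>2) ^ i = (\<Sum>j\<le>i. real (i choose j) * (- c\<^sup>2) ^ (i - j) * r ^ (2 * j))"
      using binomial_ring[of "r\<^sup>2" "- c\<^sup>2" i] by (simp add: mult_ac flip: power_mult)
    also have "\<dots> = (\<Sum>j<N. real (i choose j) * (- c\<^sup>2) ^ (i - j) * r ^ (2 * j))"
      using that by (intro sum.mono_neutral_left) auto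
    finally show ?thesis .
  qed
  have "(\<Sum>i<N. y i * (r\<^sup>2 - c\<^sup>2) ^ i / double_fact (2 * i))
      = (\<Sum>i<N. \<Sum>j<N. y i * (real (i choose j) * (- c\<^sup>2) ^ (i - j) / double_fact (2 * i)) * r ^ (2 * j))"
    by (intro sum.cong refl) (simp add: binom sum_distrib_left sum_divide_distrib mult_ac)
  also have "\<dots> = (\<Sum>j<N. radial_coeff N c y j * r ^ (2 * j))"
    by (subst sum.swap) (simp add: radial_coeff_def sum_distrib_right)
  finally show ?thesis .
qed

lemma radial_coeff_eq_0: "N \<le> j \<Longrightarrow> radial_coeff N c y j = 0"
  by (auto simp: radial_coeff_def intro!: sum.neutral)

text \<open>The linear map from \<open>y\<close> to the coefficients is triangular with nonzero
  diagonal. The top entry of \<open>y\<close> is therefore forced, and its contribution to the lower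
  coefficients is subtracted before the induction hypothesis is used.\<close>

lemma radial_coeff_surj: "\<exists>y. \<forall>j<N. radial_coeff N c y j = \<alpha> j"
proof (induction N arbitrary: \<alpha>)
  case (Suc N)
  obtain y where y: "\<And>j. j < N \<Longrightarrow>
      radial_coeff N c y j = \<alpha> j - \<alpha> N * (real (N choose j) * (- c\<^sup>2) ^ (N - j))"
    using Suc[of "\<lambda>j. \<alpha> j - \<alpha> N * (real (N choose j) * (- c\<^sup>2) ^ (N - j))"] by blast
  define y' where "y' = y(N := \<alpha> N * double_fact (2 * N))"
  have "radial_coeff (Suc N) c y' j = \<alpha> j" if "j < Suc N" for j
  proof -
    have "radial_coeff N c y' j = radial_coeff N c y j"
      by (simp add: radial_coeff_def y'_def)
    then have "radial_coeff (Suc N) c y' j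
        = radial_coeff N c y j + \<alpha> N * (real (N choose j) * (- c\<^sup>2) ^ (N - j))"
      using double_fact_even_pos[of N] by (simp add: radial_coeff_def y'_def)
    then show ?thesis
      using that y by (cases "j = N") (simp_all add: radial_coeff_eq_0)
  qed
  then show ?case
    by blast
qed simp

text \<open>If \<open>z\<close> lists the values of the \<open>C i\<close> at r = c, the first
  argument lists the x-derivatives of the \<open>A i\<close> there. The weights satisfy 2 (i - j)
  w(i) = -c^2 w(i - 1), because (i - j) (i choose j) = i (i - 1 choose j), so the sum telescopes to
  its last term.\<close>

lemma radial_coeff_alpha:
  "radial_coeff (Suc n) c (\<lambda>i. c\<^sup>2 * z (Suc i) + (2 * real i + 1) * z i) j
     - (2 * real j + 1) * radial_coeff (Suc n) c z j
   = z (Suc n) * c\<^sup>2 * (real (n choose j) * (- c\<^sup>2) ^ (n - j) / double_fact (2 * n))"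
proof -
  define w where "w i = real (i choose j) * (- c\<^sup>2) ^ (i - j) / double_fact (2 * i)" for i
  \<comment> \<open>The value 0 at \<open>i = 0\<close> stands for the missing weight with index -1
    and removes the lower end of the telescope.\<close>
  define T where "T i = (if i = 0 then 0 else z i * c\<^sup>2 * w (i - 1))" for i
  have step: "(2 * real i + 1) * w i - (2 * real j + 1) * w i = - (if i = 0 then 0 else c\<^sup>2 * w (i - 1))"
    for i
  proof (cases i)
    case 0
    then show ?thesis
      by (cases j) (simp_all add: w_def)
  next
    case (Suc l)
    have df: "real (double_fact (2 * i)) = 2 * real (Suc l) * double_fact (2 * l)"
      by (simp add: Suc algebra_simps)
    consider "j \<le> l" | "j = Suc l" | "Suc l < j"
      by linarith
    then show ?thesis
    proof cases
      case 1
      have "real ((Suc l - j) * (Suc l choose j)) = real (Suc l * (l choose j))"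
        using binomial_absorb_comp[of "Suc l" j] by simp
      then have "(real (Suc l) - real j) * real (Suc l choose j) = real (Suc l) * real (l choose j)"
        using of_nat_diff[of j "Suc l", where 'a = real, OF le_SucI[OF 1]] by (simp only: of_nat_mult)
      moreover have "(2 * real i + 1) * w i - (2 * real j + 1) * w i
          = ((real (Suc l) - real j) * real (Suc l choose j)) * ((- c\<^sup>2) * (- c\<^sup>2) ^ (l - j))
            / (real (Suc l) * double_fact (2 * l))"
      proof -
        have cancel: "(2 * L + 1) * (b * q / (2 * L * d)) - (2 * J + 1) * (b * q / (2 * L * d))
            = (L - J) * b * q / (L * d)" if "L \<noteq> 0" "d \<noteq> 0" for J b q L d :: real
          using that by (simp add: field_simps)
        have "(- c\<^sup>2) ^ (Suc l - j) = (- c\<^sup>2) * (- c\<^sup>2) ^ (l - j)"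
          using 1 by (simp add: Suc_diff_le)
        then show ?thesis
          unfolding w_def df using cancel[of "real (Suc l)" "double_fact (2 * l)"] double_fact_even_pos[of l]
          by (simp only: Suc)
      qed
      ultimately show ?thesis
        using double_fact_even_pos[of l] by (simp add: Suc w_def divide_simps del: of_nat_Suc)
    qed (simp_all add: Suc w_def binomial_eq_0)
  qed
  have "radial_coeff (Suc n) c (\<lambda>i. c\<^sup>2 * z (Suc i) + (2 * real i + 1) * z i) j
       - (2 * real j + 1) * radial_coeff (Suc n) c z j
     = (\<Sum>i<Suc n. c\<^sup>2 * z (Suc i) * w i + z i * ((2 * real i + 1) * w i - (2 * real j + 1) * w i))"
    unfolding radial_coeff_def w_def[symmetric] sum_distrib_left sum_subtractf[symmetric]
    by (intro sum.cong refl) (simp add: algebra_simps)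
  also have "\<dots> = (\<Sum>i<Suc n. T (Suc i) - T i)"
    unfolding step by (intro sum.cong refl) (simp add: T_def)
  also have "\<dots> = T (Suc n)"
    unfolding sum_lessThan_telescope by (simp add: T_def)
  finally show ?thesis
    by (simp add: T_def w_def)
qed

text \<open>The counterpart for values \<open>y\<close> of the \<open>A i\<close> at r = c, whose
  negated shifts are the x-derivatives of the \<open>C i\<close>. Now the weights with indices
  \<open>j + 1\<close> and \<open>j\<close> are related: 2 (j + 1) w(j + 1, i) = w(j, i - 1), from
  the absorption identity for binomials.\<close>

lemma radial_coeff_beta:
  "radial_coeff (Suc n) c (\<lambda>i. - y (Suc i)) j + 2 * (real j + 1) * radial_coeff (Suc n) c y (j + 1)
   = - y (Suc n) * (real (n choose j) * (- c\<^sup>2) ^ (n - j) / double_fact (2 * n))"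
proof -
  define w where "w j i = real (i choose j) * (- c\<^sup>2) ^ (i - j) / double_fact (2 * i)" for i j
  define T where "T i = (if i = 0 then 0 else - y i * w j (i - 1))" for i
  have step: "2 * (real j + 1) * w (j + 1) i = (if i = 0 then 0 else w j (i - 1))" for i
  proof (cases i)
    case (Suc l)
    have df: "real (double_fact (2 * i)) = 2 * real (Suc l) * double_fact (2 * l)"
      by (simp add: Suc algebra_simps)
    have "real (Suc l * (l choose j)) = real ((Suc l choose Suc j) * Suc j)"
      using Suc_times_binomial_eq[of l j] by simp
    then have "real (Suc l choose Suc j) * (real j + 1) = real (Suc l) * real (l choose j)"
      by (simp only: of_nat_mult) (simp add: algebra_simps)
    moreover have "2 * (real j + 1) * w (j + 1) i = (real (Suc l choose Suc j) * (real j + 1))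
        * (- c\<^sup>2) ^ (l - j) / (real (Suc l) * double_fact (2 * l))"
    proof -
      have "2 * J * (b * q / (2 * L * d)) = b * J * q / (L * d)" for J b q L d :: real
        by simp
      then show ?thesis
        unfolding w_def df by (simp only: Suc Suc_eq_plus1[symmetric] diff_Suc_Suc)
    qed
    ultimately show ?thesis
      using double_fact_even_pos[of l] by (simp add: Suc w_def divide_simps del: of_nat_Suc)
  qed (simp add: w_def)
  have "radial_coeff (Suc n) c (\<lambda>i. - y (Suc i)) j + 2 * (real j + 1) * radial_coeff (Suc n) c y (j + 1)
     = (\<Sum>i<Suc n. - y (Suc i) * w j i + y i * (2 * (real j + 1) * w (j + 1) i))"
    unfolding radial_coeff_def w_def[symmetric] sum_distrib_left sum.distrib[symmetric]
    by (intro sum.cong refl) (simp add: algebra_simps)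
  also have "\<dots> = (\<Sum>i<Suc n. T (Suc i) - T i)"
    unfolding step by (intro sum.cong refl) (simp add: T_def)
  also have "\<dots> = T (Suc n)"
    unfolding sum_lessThan_telescope by (simp add: T_def)
  finally show ?thesis
    by (simp add: T_def w_def)
qed

section \<open>Differential equations for the coefficients\<close>

lemma radial_coeff_has_derivative:
  assumes "\<And>i. i < N \<Longrightarrow> (y i has_real_derivative y' i) (at x within S)"
  shows "((\<lambda>x. radial_coeff N c (\<lambda>i. y i x) j) has_real_derivative radial_coeff N c y' j) (at x within S)"
  unfolding radial_coeff_def
proof (rule DERIV_sum)
  fix i
  assume "i \<in> {..<N}"
  then show "((\<lambda>x. y i x * (real (i choose j) * (- c\<^sup>2) ^ (i - j) / double_fact (2 * i)))
      has_real_derivative y' i * (real (i choose j) * (- c\<^sup>2) ^ (i - j) / double_fact (2 * i))) (at x within S)"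
    by (intro DERIV_cmult_right assms) simp
qed

text \<open>The system is triangular: \<open>q (N - 1)\<close> is constant, it determines
  \<open>p (N - 1)\<close>, which determines \<open>q (N - 2)\<close>, and so on downwards. The
  induction runs over the distance from the top index, and each step needs only that a function with
  zero derivative and zero initial value vanishes.\<close>

lemma coupled_system_unique:
  fixes p q p' q' :: "nat \<Rightarrow> real \<Rightarrow> real"
  assumes D: "\<And>x j. x \<in> {a..b} \<Longrightarrow> j < N \<Longrightarrow> (p j has_real_derivative p' j x) (at x within {a..b})"
      "\<And>x j. x \<in> {a..b} \<Longrightarrow> j < N \<Longrightarrow> (q j has_real_derivative q' j x) (at x within {a..b})"
    and eqs: "\<And>x j. x \<in> {a..b} \<Longrightarrow> j < N \<Longrightarrow> p' j x = (2 * real j + 1) * q j x"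
      "\<And>x j. x \<in> {a..b} \<Longrightarrow> j < N - 1 \<Longrightarrow> q' j x = - 2 * (real j + 1) * p (j + 1) x"
      "\<And>x. x \<in> {a..b} \<Longrightarrow> q' (N - 1) x = 0"
    and init: "\<And>j. j < N \<Longrightarrow> p j a = 0" "\<And>j. j < N \<Longrightarrow> q j a = 0"
    and x: "x \<in> {a..b}" and j: "j < N"
  shows "p j x = 0 \<and> q j x = 0"
proof -
  have const: "f x = 0" if "\<And>x. x \<in> {a..b} \<Longrightarrow> (f has_real_derivative f' x) (at x within {a..b})"
    "\<And>x. x \<in> {a..b} \<Longrightarrow> f' x = 0" "f a = 0" "x \<in> {a..b}" for f f' :: "real \<Rightarrow> real" and x
  proof -
    have "\<exists>k. \<forall>x\<in>{a..b}. f x = k"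
      using that by (intro has_field_derivative_zero_constant) fastforce+
    moreover have "a \<in> {a..b}"
      using that(4) by auto
    ultimately show ?thesis
      using that(3,4) by metis
  qed
  have "\<forall>x\<in>{a..b}. p j x = 0 \<and> q j x = 0" if "j + n = N - 1" "j < N" for j n
    using that
  proof (induction n arbitrary: j)
    case 0
    then have "q j x = 0" if "x \<in> {a..b}" for x
      by (intro const[OF D(2) _ init(2) that, of j]) (use eqs(3) in auto)
    moreover from this have "p j x = 0" if "x \<in> {a..b}" for x
      by (intro const[OF D(1) _ init(1) that, of j]) (use eqs(1) 0 in auto)
    ultimately show ?case
      by blast
  next
    case (Suc n)
    then have "\<forall>x\<in>{a..b}. p (j + 1) x = 0"
      by (cases "j + 1 < N") auto
    then have "q j x = 0" if "x \<in> {a..b}" for x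
      by (intro const[OF D(2) _ init(2) that, of j]) (use eqs(2) Suc.prems in auto)
    moreover from this have "p j x = 0" if "x \<in> {a..b}" for x
      by (intro const[OF D(1) _ init(1) that, of j]) (use eqs(1) Suc.prems in auto)
    ultimately show ?case
      by blast
  qed
  from this[of j "N - 1 - j"] show ?thesis
    using x j by auto
qed

section \<open>Construction of chains by the Poincare lemma\<close>

definition C1_partials ::
  "(real \<times> real \<Rightarrow> real) \<Rightarrow> (real \<times> real \<Rightarrow> real) \<Rightarrow> (real \<times> real \<Rightarrow> real) \<Rightarrow> (real \<times> real) set \<Rightarrow> bool" where
  "C1_partials f f1 f2 W \<longleftrightarrow>
    (\<forall>p\<in>W. (f has_derivative (\<lambda>h. fst h * f1 p + snd h * f2 p)) (at p)) \<and>
    continuous_on W f1 \<and> continuous_on W f2"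

lemma C1_partialsD:
  assumes "C1_partials f f1 f2 W"
  shows "p \<in> W \<Longrightarrow> (f has_derivative (\<lambda>h. fst h * f1 p + snd h * f2 p)) (at p)"
    "continuous_on W f1" "continuous_on W f2" "continuous_on W f"
proof -
  show D: "p \<in> W \<Longrightarrow> (f has_derivative (\<lambda>h. fst h * f1 p + snd h * f2 p)) (at p)" for p
    using assms by (simp add: C1_partials_def)
  show "continuous_on W f1" "continuous_on W f2"
    using assms by (simp_all add: C1_partials_def)
  show "continuous_on W f"
    by (rule has_derivative_continuous_on[OF has_derivative_at_withinI[OF D]])
qed

lemma C1_partials_along_axes:
  assumes "C1_partials f f1 f2 W" "(x, r) \<in> W"
  shows "((\<lambda>x. f (x, r)) has_real_derivative f1 (x, r)) (at x)"
    "((\<lambda>r. f (x, r)) has_real_derivative f2 (x, r)) (at r)"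
proof -
  have line: "((\<lambda>t. f (p t)) has_real_derivative fst v * f1 (x, r) + snd v * f2 (x, r)) (at t)"
    if "(p has_derivative (\<lambda>h. h *\<^sub>R v)) (at t)" "p t = (x, r)" for p v t
  proof -
    have "(f has_derivative (\<lambda>h. fst h * f1 (x, r) + snd h * f2 (x, r))) (at (p t))"
      using C1_partialsD(1)[OF assms] that(2) by simp
    from has_derivative_compose[OF that(1) this] show ?thesis
      by (rule has_derivative_imp_has_field_derivative) (simp add: algebra_simps)
  qed
  have "((\<lambda>x. (x, r)) has_derivative (\<lambda>h. h *\<^sub>R (1, 0))) (at x)"
    by (auto intro!: derivative_eq_intros)
  from line[OF this] show "((\<lambda>x. f (x, r)) has_real_derivative f1 (x, r)) (at x)"
    by simp
  have "((\<lambda>r. (x, r)) has_derivative (\<lambda>h. h *\<^sub>R (0, 1))) (at r)"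
    by (auto intro!: derivative_eq_intros)
  from line[OF this] show "((\<lambda>r. f (x, r)) has_real_derivative f2 (x, r)) (at r)"
    by simp
qed

text \<open>The primitive of the closed form f dx + g dr is its integral along the segment from
  \<open>p0\<close> to \<open>p\<close>, differentiated under the integral sign. The additive
  constant gives any value at \<open>p0\<close>.\<close>

lemma poincare_convex:
  assumes W: "open W" "convex W" "p0 \<in> W"
    and f: "C1_partials f fx fr W" and g: "C1_partials g gx gr W"
    and closed: "\<And>p. p \<in> W \<Longrightarrow> fr p = gx p"
  obtains F where "C1_partials F f g W" "F p0 = y"
proof -
  define L where "L p t = p0 + t *\<^sub>R (p - p0)" for p :: "real \<times> real" and t :: real
  define F where "F p t = fst (p - p0) * f (L p t) + snd (p - p0) * g (L p t)" for p t
  \<comment> \<open>\<open>F1\<close> and \<open>F2\<close> are the partial derivatives of the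
    integrand in \<open>p\<close>. Closedness turns them into the \<open>t\<close>-derivatives of
    \<open>t * f (L p t)\<close> and \<open>t * g (L p t)\<close>, whose integrals over [0, 1] are
    \<open>f p\<close> and \<open>g p\<close>.\<close>
  define F1 where "F1 p t = f (L p t)
      + t * (fst (p - p0) * fx (L p t) + snd (p - p0) * gx (L p t))" for p t
  define F2 where "F2 p t = g (L p t)
      + t * (fst (p - p0) * fr (L p t) + snd (p - p0) * gr (L p t))" for p t
  have L_in: "L p t \<in> W" if "p \<in> W" "t \<in> {0..1}" for p t
  proof -
    have "L p t = (1 - t) *\<^sub>R p0 + t *\<^sub>R p"
      by (simp add: L_def algebra_simps)
    then show ?thesis
      using that W(2,3) by (simp add: convex_alt)
  qed
  have L_cont: "continuous_on (W \<times> {0..1}) (\<lambda>z. L (fst z) (snd z))"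
    unfolding L_def by (intro continuous_intros)
  have cont: "continuous_on (W \<times> cbox 0 1) (\<lambda>z. h (L (fst z) (snd z)))"
    if "continuous_on W h" for h :: "real \<times> real \<Rightarrow> real"
    unfolding cbox_interval by (rule continuous_on_compose2[OF that L_cont]) (auto simp: L_in)
  have cont_t: "continuous_on (cbox 0 1) (\<lambda>t. h (L p t))"
    if "continuous_on W h" "p \<in> W" for h :: "real \<times> real \<Rightarrow> real" and p
    unfolding cbox_interval
    by (rule continuous_on_compose2[OF that(1)])
       (auto simp: L_in that(2), auto simp: L_def intro!: continuous_intros)
  note Df = C1_partialsD[OF f] and Dg = C1_partialsD[OF g]
  define F' where "F' p t = F1 p t *\<^sub>R Blinfun fst + F2 p t *\<^sub>R (Blinfun snd :: (real \<times> real) \<Rightarrow>\<^sub>L real)"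
    for p t
  have F'_apply: "blinfun_apply (F' p t) = (\<lambda>h. fst h * F1 p t + snd h * F2 p t)" for p t
    by (simp add: F'_def fun_eq_iff blinfun.bilinear_simps bounded_linear_Blinfun_apply
        bounded_linear_fst bounded_linear_snd mult.commute)
  have F_deriv: "((\<lambda>p. F p t) has_derivative blinfun_apply (F' p t)) (at p within W)"
    if "p \<in> W" "t \<in> cbox 0 1" for p t
  proof -
    have L': "((\<lambda>p. L p t) has_derivative (\<lambda>h. t *\<^sub>R h)) (at p)"
      unfolding L_def by (auto intro!: derivative_eq_intros simp: algebra_simps)
    have Lp: "L p t \<in> W"
      using L_in that by simp
    note f' = has_derivative_compose[OF L' Df(1)[OF Lp]] and g' = has_derivative_compose[OF L' Dg(1)[OF Lp]]
    have "((\<lambda>p. F p t) has_derivative (\<lambda>h. (fst (p - p0) * (fst (t *\<^sub>R h) * fx (L p t) + snd (t *\<^sub>R h) * fr (L p t))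
        + fst h * f (L p t)) + (snd (p - p0) * (fst (t *\<^sub>R h) * gx (L p t) + snd (t *\<^sub>R h) * gr (L p t))
        + snd h * g (L p t)))) (at p)"
      unfolding F_def
      by (intro has_derivative_add has_derivative_mult f' g') (auto intro!: derivative_eq_intros)
    then have "((\<lambda>p. F p t) has_derivative blinfun_apply (F' p t)) (at p)"
      by (rule has_derivative_eq_rhs)
         (simp add: F'_apply F1_def F2_def fun_eq_iff closed[OF Lp] algebra_simps)
    then show ?thesis
      by (rule has_derivative_at_withinI)
  qed
  have F'_cont: "continuous_on (W \<times> cbox 0 1) (\<lambda>(p, t). F' p t)"
  proof (rule continuous_on_blinfun_componentwise)
    fix i :: "real \<times> real"
    show "continuous_on (W \<times> cbox 0 1) (\<lambda>z. blinfun_apply (case z of (p, t) \<Rightarrow> F' p t) i)"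
      unfolding case_prod_unfold F'_apply F1_def F2_def
      by (intro continuous_intros cont Df Dg)
  qed
  have deriv: "((\<lambda>p. integral (cbox 0 1) (F p)) has_derivative blinfun_apply (integral (cbox 0 1) (F' p)))
      (at p within W)" if p: "p \<in> W" for p
  proof (rule leibniz_rule[OF F_deriv _ F'_cont p W(2)])
    show "F p integrable_on cbox 0 1" if "p \<in> W" for p
      unfolding F_def using that
      by (intro integrable_continuous continuous_intros cont_t Df Dg)
  qed
  have int: "blinfun_apply (integral (cbox 0 1) (F' p)) = (\<lambda>h. fst h * f p + snd h * g p)"
    if p: "p \<in> W" for p
  proof -
    have "continuous_on (cbox 0 1) (\<lambda>t. F' p t)"
    proof (rule continuous_on_blinfun_componentwise)
      fix i :: "real \<times> real"
      show "continuous_on (cbox 0 1) (\<lambda>t. blinfun_apply (F' p t) i)"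
        unfolding F'_apply F1_def F2_def using p by (intro continuous_intros cont_t Df Dg)
    qed
    then have F'_int: "F' p integrable_on cbox 0 1"
      by (rule integrable_continuous)
    have line: "((\<lambda>t. h (L p t)) has_real_derivative
        fst (p - p0) * hx (L p t) + snd (p - p0) * hr (L p t)) (at t within {0..1})"
      if "C1_partials h hx hr W" "t \<in> {0..1}" for h hx hr t
    proof -
      have "(L p has_derivative (\<lambda>s. s *\<^sub>R (p - p0))) (at t)"
        unfolding L_def by (auto intro!: derivative_eq_intros)
      from has_derivative_compose[OF this C1_partialsD(1)[OF that(1) L_in[OF p that(2)]]]
      have "((\<lambda>t. h (L p t)) has_real_derivative
          fst (p - p0) * hx (L p t) + snd (p - p0) * hr (L p t)) (at t)"
        by (rule has_derivative_imp_has_field_derivative) (simp add: algebra_simps)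
      then show ?thesis
        by (rule has_field_derivative_at_within)
    qed
    have "((\<lambda>t. t * f (L p t)) has_real_derivative F1 p t) (at t within {0..1})"
      "((\<lambda>t. t * g (L p t)) has_real_derivative F2 p t) (at t within {0..1})" if t: "t \<in> {0..1}" for t
      using DERIV_mult[OF DERIV_ident line[OF f t]] DERIV_mult[OF DERIV_ident line[OF g t]]
        closed[OF L_in[OF p t]]
      by (simp_all add: F1_def F2_def algebra_simps)
    then have "(F1 p has_integral 1 * f (L p 1) - 0 * f (L p 0)) {0..1}"
      "(F2 p has_integral 1 * g (L p 1) - 0 * g (L p 0)) {0..1}"
      by (intro fundamental_theorem_of_calculus;
          simp add: has_real_derivative_iff_has_vector_derivative)+
    then have F12: "(F1 p has_integral f p) (cbox 0 1)" "(F2 p has_integral g p) (cbox 0 1)"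
      by (simp_all add: L_def)
    have "integral (cbox 0 1) (\<lambda>t. fst h * F1 p t + snd h * F2 p t) = fst h * f p + snd h * g p" for h
      by (intro integral_unique has_integral_add has_integral_mult_right F12)
    then show ?thesis
      by (intro ext) (simp only: blinfun_apply_integral[OF F'_int] F'_apply)
  qed
  let ?G = "\<lambda>p. integral (cbox 0 1) (F p) + y"
  have "C1_partials ?G f g W"
    unfolding C1_partials_def
  proof (intro conjI ballI Df(4) Dg(4))
    fix p assume p: "p \<in> W"
    have "(?G has_derivative (\<lambda>h. fst h * f p + snd h * g p)) (at p within W)"
      using has_derivative_add[OF deriv[OF p] has_derivative_const] by (simp only: int[OF p] add_0_right)
    then show "(?G has_derivative (\<lambda>h. fst h * f p + snd h * g p)) (at p)"
      using at_within_open[OF p W(1)] by simp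
  qed
  moreover have "?G p0 = y"
  proof -
    have "F p0 = (\<lambda>t. 0)"
      by (simp add: F_def fun_eq_iff)
    then show ?thesis
      by simp
  qed
  ultimately show ?thesis
    by (rule that)
qed

text \<open>This is the Vekua system for \<open>A\<close> and B = r C with 2 n in place of 2 k + m -
  1, rewritten without division. For n = 0 it is the Cauchy-Riemann system.\<close>

definition vekua_pair :: "nat \<Rightarrow> (real \<times> real \<Rightarrow> real) \<Rightarrow> (real \<times> real \<Rightarrow> real) \<Rightarrow> (real \<times> real) set \<Rightarrow> bool" where
  "vekua_pair n A C W \<longleftrightarrow> (\<exists>Ax Ar Cx Cr. C1_partials A Ax Ar W \<and> C1_partials C Cx Cr W \<and>
    (\<forall>p\<in>W. Ax p = snd p * Cr p + (2 * real n + 1) * C p \<and> snd p * Cx p = - Ar p))"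

text \<open>One inversion of \<delta>: the r-derivatives of \<open>A'\<close> and \<open>C'\<close>
  are to be r A and r C, and the chain equations prescribe their x-derivatives. The two equations of
  the given pair are exactly the closedness conditions of the resulting forms.\<close>

lemma vekua_pair_descend:
  assumes W: "open W" "convex W" "p0 \<in> W" and AC: "vekua_pair (Suc n) A C W"
  obtains A' C' where "vekua_pair n A' C' W"
    "C1_partials A' (\<lambda>p. (snd p)\<^sup>2 * C p + (2 * real n + 1) * C' p) (\<lambda>p. snd p * A p) W"
    "C1_partials C' (\<lambda>p. - A p) (\<lambda>p. snd p * C p) W"
    "A' p0 = y" "C' p0 = z"
proof -
  obtain Ax Ar Cx Cr where A: "C1_partials A Ax Ar W" and C: "C1_partials C Cx Cr W"
    and eqs: "\<And>p. p \<in> W \<Longrightarrow> Ax p = snd p * Cr p + (2 * real (Suc n) + 1) * C p"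
      "\<And>p. p \<in> W \<Longrightarrow> snd p * Cx p = - Ar p"
    using AC unfolding vekua_pair_def by blast
  note DA = C1_partialsD[OF A] and DC = C1_partialsD[OF C]
  have negA: "C1_partials (\<lambda>p. - A p) (\<lambda>p. - Ax p) (\<lambda>p. - Ar p) W"
    unfolding C1_partials_def
    by (intro conjI ballI continuous_intros DA has_derivative_eq_rhs[OF has_derivative_minus[OF DA(1)]])
       (simp_all add: algebra_simps fun_eq_iff)
  have mult_snd: "C1_partials (\<lambda>p. snd p * f p) (\<lambda>p. snd p * fx p) (\<lambda>p. f p + snd p * fr p) W"
    if f: "C1_partials f fx fr W" for f fx fr
    unfolding C1_partials_def
    by (intro conjI ballI continuous_intros C1_partialsD[OF f]
        has_derivative_eq_rhs[OF has_derivative_mult[OF has_derivative_snd[OF has_derivative_ident] C1_partialsD(1)[OF f]]])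
       (simp_all add: algebra_simps fun_eq_iff)
  \<comment> \<open>\<open>C'\<close> is built first, since it occurs in the form whose primitive is
    \<open>A'\<close>.\<close>
  obtain C' where C': "C1_partials C' (\<lambda>p. - A p) (\<lambda>p. snd p * C p) W" "C' p0 = z"
    using poincare_convex[OF W negA mult_snd[OF C]] eqs(2) by (metis (no_types, lifting))
  have "C1_partials (\<lambda>p. (snd p)\<^sup>2 * C p + (2 * real n + 1) * C' p)
      (\<lambda>p. snd p * (snd p * Cx p) + (2 * real n + 1) * - A p)
      (\<lambda>p. (snd p * C p + snd p * (C p + snd p * Cr p)) + (2 * real n + 1) * (snd p * C p)) W"
    unfolding C1_partials_def
    by (intro conjI ballI continuous_intros DA DC
        has_derivative_eq_rhs[OF has_derivative_add[OF C1_partialsD(1)[OF mult_snd[OF mult_snd[OF C]]]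
            has_derivative_mult_right[OF C1_partialsD(1)[OF C'(1)]]], unfolded mult.assoc[symmetric] power2_eq_square[symmetric]])
       (simp_all add: algebra_simps fun_eq_iff power2_eq_square)
  from poincare_convex[OF W this mult_snd[OF A]]
  obtain A' where A': "C1_partials A' (\<lambda>p. (snd p)\<^sup>2 * C p + (2 * real n + 1) * C' p) (\<lambda>p. snd p * A p) W"
    "A' p0 = y"
    using eqs(1) by (auto simp: algebra_simps)
  have "vekua_pair n A' C' W"
    unfolding vekua_pair_def
    by (rule exI[of _ "\<lambda>p. (snd p)\<^sup>2 * C p + (2 * real n + 1) * C' p"], rule exI[of _ "\<lambda>p. snd p * A p"],
        rule exI[of _ "\<lambda>p. - A p"], rule exI[of _ "\<lambda>p. snd p * C p"])
       (use A' C' in \<open>simp add: power2_eq_square\<close>)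
  then show ?thesis
    using that A' C' by blast
qed

lemma vekua_pair_chain:
  assumes W: "open W" "convex W" "p0 \<in> W" and AC: "vekua_pair N A C W"
  shows "\<exists>As Cs. As N = A \<and> Cs N = C \<and> (\<forall>s<N.
    C1_partials (As s) (\<lambda>p. (snd p)\<^sup>2 * Cs (Suc s) p + (2 * real s + 1) * Cs s p) (\<lambda>p. snd p * As (Suc s) p) W \<and>
    C1_partials (Cs s) (\<lambda>p. - As (Suc s) p) (\<lambda>p. snd p * Cs (Suc s) p) W \<and>
    As s p0 = y s \<and> Cs s p0 = z s)"
  using AC
proof (induction N arbitrary: A C)
  case 0
  show ?case
    by (rule exI[of _ "\<lambda>_. A"], rule exI[of _ "\<lambda>_. C"]) simp
next
  case (Suc n)
  obtain A' C' where AC': "vekua_pair n A' C' W"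
    "C1_partials A' (\<lambda>p. (snd p)\<^sup>2 * C p + (2 * real n + 1) * C' p) (\<lambda>p. snd p * A p) W"
    "C1_partials C' (\<lambda>p. - A p) (\<lambda>p. snd p * C p) W" "A' p0 = y n" "C' p0 = z n"
    using vekua_pair_descend[OF W Suc.prems] by blast
  from Suc.IH[OF AC'(1)] obtain As Cs where IH: "As n = A'" "Cs n = C'" "\<forall>s<n.
    C1_partials (As s) (\<lambda>p. (snd p)\<^sup>2 * Cs (Suc s) p + (2 * real s + 1) * Cs s p) (\<lambda>p. snd p * As (Suc s) p) W \<and>
    C1_partials (Cs s) (\<lambda>p. - As (Suc s) p) (\<lambda>p. snd p * Cs (Suc s) p) W \<and>
    As s p0 = y s \<and> Cs s p0 = z s"
    by (elim exE conjE)
  show ?case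
    by (rule exI[of _ "As(Suc n := A)"], rule exI[of _ "Cs(Suc n := C)"])
       (use IH AC' in \<open>auto simp: less_Suc_eq\<close>)
qed

text \<open>Descending to index 0 ends in the Cauchy-Riemann equations for the real part A 0 and the
  imaginary part r C 0. The descent only has indices up to \<open>N\<close>; the full chain is the
  one generated by \<open>g\<close>, and it agrees with the descent as far as that reaches.\<close>

lemma vekua_pair_holomorphic:
  assumes W: "open W" "convex W" "p0 \<in> W" "W \<subseteq> UNIV \<times> {0<..}"
    and AC: "vekua_pair N A C W" and N: "0 < N"
  obtains g A' C' where "g holomorphic_on {z. (Re z, Im z) \<in> W}" "fueter_chain W A' C'"
    "\<And>x r. A' 0 x r = Re (g (Complex x r))" "\<And>x r. C' 0 x r = Im (g (Complex x r)) / r"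
    "\<And>x r. (x, r) \<in> W \<Longrightarrow> A' N x r = A (x, r)" "\<And>x r. (x, r) \<in> W \<Longrightarrow> C' N x r = C (x, r)"
    "\<And>s. s < N \<Longrightarrow> A' s (fst p0) (snd p0) = y s" "\<And>s. s < N \<Longrightarrow> C' s (fst p0) (snd p0) = z s"
proof -
  obtain As Cs where top: "As N = A" "Cs N = C" and chain: "\<forall>s<N.
    C1_partials (As s) (\<lambda>p. (snd p)\<^sup>2 * Cs (Suc s) p + (2 * real s + 1) * Cs s p) (\<lambda>p. snd p * As (Suc s) p) W \<and>
    C1_partials (Cs s) (\<lambda>p. - As (Suc s) p) (\<lambda>p. snd p * Cs (Suc s) p) W \<and>
    As s p0 = y s \<and> Cs s p0 = z s"
    using vekua_pair_chain[OF W(1,2,3) AC, of y z] by (elim exE conjE)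
  note DA = C1_partialsD(1)[OF conjunct1[OF chain[rule_format, OF N]]]
    and DC = C1_partialsD(1)[OF conjunct1[OF conjunct2[OF chain[rule_format, OF N]]]]
  define g where "g z = of_real (As 0 (Re z, Im z)) + \<i> * of_real (Im z * Cs 0 (Re z, Im z))" for z
  define U where "U = {z. (Re z, Im z) \<in> W}"
  have "open ((\<lambda>z. (Re z, Im z)) -` W)"
    by (intro open_vimage W continuous_intros)
  then have U: "open U" "U \<subseteq> {z. Im z > 0}" "\<And>x r. Complex x r \<in> U \<longleftrightarrow> (x, r) \<in> W"
    using W(4) by (auto simp: U_def vimage_def)
  have g: "g holomorphic_on U"
  proof -
    have "\<exists>D. (g has_field_derivative D) (at w)" if w: "w \<in> U" for w
    proof -
      let ?p = "(Re w, Im w)"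
      have p: "?p \<in> W"
        using w by (simp add: U_def)
      have emb: "((\<lambda>z. (Re z, Im z)) has_derivative (\<lambda>h. (Re h, Im h))) (at w)"
        by (auto intro!: derivative_eq_intros)
      let ?a = "(Im w)\<^sup>2 * Cs 1 ?p + Cs 0 ?p" and ?b = "Im w * As 1 ?p"
      have A: "((\<lambda>z. As 0 (Re z, Im z)) has_derivative (\<lambda>h. Re h * ?a + Im h * ?b)) (at w)"
        using has_derivative_compose[OF emb DA[OF p]] by simp
      have C: "((\<lambda>z. Cs 0 (Re z, Im z)) has_derivative
          (\<lambda>h. Re h * - As 1 ?p + Im h * (Im w * Cs 1 ?p))) (at w)"
        using has_derivative_compose[OF emb DC[OF p]] by simp
      have "(g has_derivative (\<lambda>h. of_real (Re h * ?a + Im h * ?b) + \<i> * of_real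
          (Im w * (Re h * - As 1 ?p + Im h * (Im w * Cs 1 ?p)) + Im h * Cs 0 ?p))) (at w)"
        unfolding g_def
        by (intro has_derivative_add has_derivative_of_real has_derivative_mult_right has_derivative_mult A C)
           (auto intro!: derivative_eq_intros)
      \<comment> \<open>The real derivative just computed is multiplication by a complex number,
        namely u_x - i u_y.\<close>
      then have "(g has_field_derivative Complex ?a (- ?b)) (at w)"
        by (rule has_derivative_imp_has_field_derivative)
           (simp add: complex_eq_iff algebra_simps power2_eq_square)
      then show ?thesis
        by blast
    qed
    then show ?thesis
      using U(1) by (simp add: holomorphic_on_open)
  qed
  obtain A' C' where ch: "fueter_chain {(x, r). Complex x r \<in> U} A' C'"
    and A0: "\<And>x r. A' 0 x r = Re (g (Complex x r))" and C0: "\<And>x r. C' 0 x r = Im (g (Complex x r)) / r"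
    using holomorphic_fueter_chain[OF g U(1,2)] by blast
  have ch: "fueter_chain W A' C'"
    using ch by (simp add: U(3))
  \<comment> \<open>Equal functions on the open set \<open>W\<close> have equal r-derivatives;
    dividing these by r > 0 passes equality from \<open>s\<close> to \<open>Suc s\<close>.\<close>
  have agree: "\<forall>x r. (x, r) \<in> W \<longrightarrow> A' s x r = As s (x, r) \<and> C' s x r = Cs s (x, r)" if "s \<le> N" for s
    using that
  proof (induction s)
    case 0
    show ?case
      using W(4) by (auto simp: A0 C0 g_def)
  next
    case (Suc s)
    show ?case
    proof (intro allI impI)
      fix x r assume p: "(x, r) \<in> W"
      have op: "open ((\<lambda>r. (x, r)) -` W)"
        by (intro open_vimage W continuous_intros)
      have local: "(f' has_real_derivative D) (at r)"
        if "(f has_real_derivative D) (at r)" "\<And>r. (x, r) \<in> W \<Longrightarrow> f r = f' r" for f f' D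
        by (rule has_field_derivative_transform_within_open[OF that(1) op]) (use p that in auto)
      have s: "s < N"
        using Suc.prems by simp
      note c = chain[rule_format, OF s]
      have "(A' s x has_real_derivative r * As (Suc s) (x, r)) (at r)"
        by (rule local[OF C1_partials_along_axes(2)[OF conjunct1[OF c] p, simplified]]) (use Suc in auto)
      moreover have "(C' s x has_real_derivative r * Cs (Suc s) (x, r)) (at r)"
        by (rule local[OF C1_partials_along_axes(2)[OF conjunct1[OF conjunct2[OF c]] p, simplified]])
           (use Suc in auto)
      ultimately have "r * A' (Suc s) x r = r * As (Suc s) (x, r)" "r * C' (Suc s) x r = r * Cs (Suc s) (x, r)"
        using fueter_chainD(1,2)[OF ch p, of s] DERIV_unique by blast+
      moreover have "r \<noteq> 0"
        using p W(4) by auto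
      ultimately show "A' (Suc s) x r = As (Suc s) (x, r) \<and> C' (Suc s) x r = Cs (Suc s) (x, r)"
        by simp
    qed
  qed
  have p0: "(fst p0, snd p0) \<in> W"
    using W(3) by simp
  show ?thesis
  proof (rule that[OF _ ch A0 C0])
    show "g holomorphic_on {z. (Re z, Im z) \<in> W}"
      using g by (simp add: U_def)
    show "A' N x r = A (x, r)" "C' N x r = C (x, r)" if "(x, r) \<in> W" for x r
      using agree[of N] that top by auto
    show "A' s (fst p0) (snd p0) = y s" "C' s (fst p0) (snd p0) = z s" if "s < N" for s
      using agree[of s] p0 that chain by auto
  qed
qed

section \<open>Fueter primitives of axial monogenic functions\<close>

lemma C1_on_imp_C1_partials:
  assumes "C1_on f W"
  shows "C1_partials f (partial_deriv (1, 0) f) (partial_deriv (0, 1) f) W"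
proof -
  obtain f' where f': "\<And>p. p \<in> W \<Longrightarrow> (f has_derivative blinfun_apply (f' p)) (at p)"
    and cont: "continuous_on W f'"
    using assms unfolding C1_on_def by blast
  have pd: "partial_deriv v f p = f' p v" if "p \<in> W" for v p
    using has_derivative_along_line[OF f'[OF that]] by (simp add: partial_deriv_def vector_derivative_at)
  have "blinfun_apply (f' p) = (\<lambda>h. fst h * f' p (1, 0) + snd h * f' p (0, 1))" for p
  proof
    fix h
    have "h = fst h *\<^sub>R (1, 0) + snd h *\<^sub>R (0, 1)"
      by (simp add: prod_eq_iff)
    then have "f' p h = f' p (fst h *\<^sub>R (1, 0) + snd h *\<^sub>R (0, 1))"
      by simp
    then show "f' p h = fst h * f' p (1, 0) + snd h * f' p (0, 1)"
      by (simp only: blinfun.add_right blinfun.scaleR_right) simp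
  qed
  then have D: "(f has_derivative (\<lambda>h. fst h * f' p (1, 0) + snd h * f' p (0, 1))) (at p)" if "p \<in> W" for p
    using f'[OF that] by metis
  have "continuous_on W (\<lambda>p. f' p v)" for v
    by (intro continuous_intros cont)
  then have "continuous_on W (partial_deriv v f)" for v
    by (rule continuous_on_eq) (simp add: pd)
  with D show ?thesis
    by (simp add: C1_partials_def pd)
qed

text \<open>Replacing B by B / r adds 1 to the coefficient, from 2 N to 2 N + 1. The scaling by
  \<open>D\<close> is meant for the double factorial (2 N)!! produced by the iterated
  Laplacian.\<close>

lemma vekua_system_imp_vekua_pair:
  assumes V: "V \<subseteq> UNIV \<times> {0<..}" and A: "C1_on A V" and B: "C1_on B V"
    and sys: "vekua_system m k A B V" and N: "2 * real N = 2 * real k + real m - 1"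
  shows "vekua_pair N (\<lambda>p. A p / D) (\<lambda>p. B p / snd p / D) V"
proof -
  note pA = C1_on_imp_C1_partials[OF A] and pB = C1_on_imp_C1_partials[OF B]
  let ?Ax = "partial_deriv (1, 0) A" and ?Ar = "partial_deriv (0, 1) A"
    and ?Bx = "partial_deriv (1, 0) B" and ?Br = "partial_deriv (0, 1) B"
  have pos: "snd p \<noteq> 0" if "p \<in> V" for p
    using V that by auto
  have scale: "C1_partials (\<lambda>p. f p / D) (\<lambda>p. fx p / D) (\<lambda>p. fr p / D) V"
    if f: "C1_partials f fx fr V" for f fx fr
    unfolding C1_partials_def divide_inverse
    by (intro conjI ballI continuous_intros C1_partialsD[OF f]
        has_derivative_eq_rhs[OF has_derivative_mult_left[OF C1_partialsD(1)[OF f]]])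
       (simp_all add: algebra_simps fun_eq_iff)
  have "C1_partials (\<lambda>p. B p / snd p) (\<lambda>p. ?Bx p / snd p) (\<lambda>p. (?Br p - B p / snd p) / snd p) V"
    unfolding C1_partials_def
  proof (intro conjI ballI)
    show "((\<lambda>p. B p / snd p) has_derivative
        (\<lambda>h. fst h * (?Bx p / snd p) + snd h * ((?Br p - B p / snd p) / snd p))) (at p)" if "p \<in> V" for p
      by (rule has_derivative_eq_rhs[OF has_derivative_divide'[OF C1_partialsD(1)[OF pB that]
              has_derivative_snd[OF has_derivative_ident] pos[OF that]]])
         (use pos[OF that] in \<open>simp add: fun_eq_iff field_simps\<close>)
    show "continuous_on V (\<lambda>p. ?Bx p / snd p)" "continuous_on V (\<lambda>p. (?Br p - B p / snd p) / snd p)"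
      by (intro continuous_intros C1_partialsD[OF pB] ballI pos; assumption)+
  qed
  note pC = scale[OF this]
  show ?thesis
    unfolding vekua_pair_def
  proof (rule exI[of _ "\<lambda>p. ?Ax p / D"], rule exI[of _ "\<lambda>p. ?Ar p / D"],
      rule exI[of _ "\<lambda>p. ?Bx p / snd p / D"], rule exI[of _ "\<lambda>p. (?Br p - B p / snd p) / snd p / D"],
      intro conjI ballI scale[OF pA] pC)
    fix p assume p: "p \<in> V"
    have 1: "?Ax p - ?Br p = 2 * real N / snd p * B p" and 2: "?Bx p = - ?Ar p"
      using sys p unfolding vekua_system_def N by (cases p; fastforce)+
    have "?Ax p = snd p * ((?Br p - B p / snd p) / snd p) + (2 * real N + 1) * (B p / snd p)"
      using 1 pos[OF p] by (simp add: field_simps)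
    then show "?Ax p / D = snd p * ((?Br p - B p / snd p) / snd p / D) + (2 * real N + 1) * (B p / snd p / D)"
      by (simp add: add_divide_distrib)
    show "snd p * (?Bx p / snd p / D) = - (?Ar p / D)"
      using 2 pos[OF p] by simp
  qed
qed

lemma vekua_pair_subset: "vekua_pair n A C V \<Longrightarrow> W \<subseteq> V \<Longrightarrow> vekua_pair n A C W"
proof -
  assume "vekua_pair n A C V" and W: "W \<subseteq> V"
  moreover have "C1_partials f fx fr W" if "C1_partials f fx fr V" for f fx fr
    using that W unfolding C1_partials_def by (auto intro: continuous_on_subset)
  ultimately show "vekua_pair n A C W"
    unfolding vekua_pair_def by blast
qed

section \<open>From a chain to the integral formulas and the differential equations\<close>

lemma fueter_const_eq:
  assumes "0 < N"
  shows "fueter_const N = 1 / (real (double_fact (2 * N)) * real (double_fact (2 * (N - 1))))"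
proof -
  obtain n where "N = Suc n"
    using assms gr0_conv_Suc by blast
  then show ?thesis
    by (simp add: fueter_const_def power2_eq_square algebra_simps)
qed

text \<open>The two double factorials in the constant have separate origins: (2 N)!! normalises the
  top function, (2 N - 2)!! belongs to the Taylor remainder.\<close>

lemma fueter_chain_expansion:
  assumes "c \<le> r" "0 < N" and f: "\<And>i t. t \<in> {c..r} \<Longrightarrow> (f i has_real_derivative t * f (Suc i) t) (at t)"
    and top: "\<And>t. t \<in> {c..r} \<Longrightarrow> real (double_fact (2 * N)) * f N t = G t"
  shows "f 0 r = fueter_const N * integral {c..r} (\<lambda>t. t * (r\<^sup>2 - t\<^sup>2) ^ (N - 1) * G t)
    + (\<Sum>j<N. radial_coeff N c (\<lambda>i. f i c) j * r ^ (2 * j))"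
proof -
  let ?D = "real (double_fact (2 * N))" and ?D' = "real (double_fact (2 * (N - 1)))"
  let ?R = "f 0 r - (\<Sum>j<N. radial_coeff N c (\<lambda>i. f i c) j * r ^ (2 * j))"
  have "((\<lambda>t. t * (r\<^sup>2 - t\<^sup>2) ^ (N - 1) * f N t / ?D') has_integral ?R) {c..r}"
    unfolding sum_radial_coeff[symmetric]
    by (rule radial_taylor[OF assms(1,2)], rule has_field_derivative_at_within, rule f)
  from has_integral_mult_right[OF this, of "?D * ?D'"]
  have "((\<lambda>t. t * (r\<^sup>2 - t\<^sup>2) ^ (N - 1) * G t) has_integral ?D * ?D' * ?R) {c..r}"
    by (rule has_integral_eq[rotated])
       (use double_fact_even_pos[of "N - 1"] in \<open>simp add: top[symmetric]\<close>)
  then have "fueter_const N * integral {c..r} (\<lambda>t. t * (r\<^sup>2 - t\<^sup>2) ^ (N - 1) * G t) = ?R"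
    using double_fact_even_pos[of N] double_fact_even_pos[of "N - 1"]
    by (simp add: fueter_const_eq[OF assms(2)] integral_unique)
  then show ?thesis
    by simp
qed

definition fueter_form ::
  "nat \<Rightarrow> real \<Rightarrow> real \<Rightarrow> real \<Rightarrow> real \<Rightarrow> (real \<times> real \<Rightarrow> real) \<Rightarrow> (real \<times> real \<Rightarrow> real) \<Rightarrow>
    (nat \<Rightarrow> real \<Rightarrow> real) \<Rightarrow> (nat \<Rightarrow> real \<Rightarrow> real) \<Rightarrow> (complex \<Rightarrow> complex) \<Rightarrow> bool" where
  "fueter_form N a b c d A B \<alpha> \<beta> h \<longleftrightarrow> (\<forall>x0\<in>{a..b}. \<forall>r\<in>{c..d}.
    Re (h (Complex x0 r)) =
      fueter_const N * integral {c..r} (\<lambda>t. t * (r\<^sup>2 - t\<^sup>2) ^ (N - 1) * A (x0, t))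
      + (\<Sum>j<N. \<alpha> j x0 * r ^ (2 * j)) \<and>
    Im (h (Complex x0 r)) =
      fueter_const N * r * integral {c..r} (\<lambda>t. (r\<^sup>2 - t\<^sup>2) ^ (N - 1) * B (x0, t))
      + (\<Sum>j<N. \<beta> j x0 * r ^ (2 * j + 1)))"

definition fueter_odes ::
  "nat \<Rightarrow> real \<Rightarrow> real \<Rightarrow> real \<Rightarrow> (real \<times> real \<Rightarrow> real) \<Rightarrow> (real \<times> real \<Rightarrow> real) \<Rightarrow>
    (nat \<Rightarrow> real \<Rightarrow> real) \<Rightarrow> (nat \<Rightarrow> real \<Rightarrow> real) \<Rightarrow> (nat \<Rightarrow> real \<Rightarrow> real) \<Rightarrow> (nat \<Rightarrow> real \<Rightarrow> real) \<Rightarrow> bool" where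
  "fueter_odes N a b c A B \<alpha> \<beta> \<alpha>' \<beta>' \<longleftrightarrow>
    (\<forall>x0\<in>{a..b}. \<forall>j<N.
      (\<alpha> j has_real_derivative \<alpha>' j x0) (at x0 within {a..b}) \<and>
      (\<beta> j has_real_derivative \<beta>' j x0) (at x0 within {a..b})) \<and>
    (\<forall>x0\<in>{a..b}.
      (\<forall>j<N. \<alpha>' j x0 - (2 * real j + 1) * \<beta> j x0 =
        (-1) ^ (N - j - 1) * fueter_const N * real ((N - 1) choose j)
          * c ^ (2 * (N - j) - 1) * B (x0, c)) \<and>
      (\<forall>j<N - 1. \<beta>' j x0 + 2 * (real j + 1) * \<alpha> (j + 1) x0 =
        (-1) ^ (N - j) * fueter_const N * real ((N - 1) choose j)
          * c ^ (2 * (N - j - 1)) * A (x0, c)) \<and>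
      \<beta>' (N - 1) x0 = - fueter_const N * A (x0, c))"

text \<open>The inhomogeneous terms cancel in the difference of two solutions, which leaves the
  homogeneous system of \<open>coupled_system_unique\<close>.\<close>

lemma fueter_odes_unique:
  assumes 1: "fueter_odes N a b c A B \<alpha> \<beta> \<alpha>' \<beta>'" and 2: "fueter_odes N a b c A B \<gamma> \<delta> \<gamma>' \<delta>'"
    and init: "\<And>j. j < N \<Longrightarrow> \<alpha> j a = \<gamma> j a" "\<And>j. j < N \<Longrightarrow> \<beta> j a = \<delta> j a"
    and "x \<in> {a..b}" "j < N"
  shows "\<alpha> j x = \<gamma> j x \<and> \<beta> j x = \<delta> j x"
proof -
  note D1 = 1[unfolded fueter_odes_def, THEN conjunct1, rule_format]
    and D2 = 2[unfolded fueter_odes_def, THEN conjunct1, rule_format]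
  note E1 = 1[unfolded fueter_odes_def, THEN conjunct2, THEN bspec]
    and E2 = 2[unfolded fueter_odes_def, THEN conjunct2, THEN bspec]
  have "\<alpha> j x - \<gamma> j x = 0 \<and> \<beta> j x - \<delta> j x = 0"
  proof (rule coupled_system_unique[where p = "\<lambda>j x. \<alpha> j x - \<gamma> j x" and q = "\<lambda>j x. \<beta> j x - \<delta> j x"
        and p' = "\<lambda>j x. \<alpha>' j x - \<gamma>' j x" and q' = "\<lambda>j x. \<beta>' j x - \<delta>' j x", OF _ _ _ _ _ _ _ assms(5,6)])
    fix x j assume x: "x \<in> {a..b}"
    show "((\<lambda>x. \<alpha> j x - \<gamma> j x) has_real_derivative \<alpha>' j x - \<gamma>' j x) (at x within {a..b})" if "j < N"
      by (rule DERIV_diff[OF conjunct1[OF D1[OF x that]] conjunct1[OF D2[OF x that]]])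
    show "((\<lambda>x. \<beta> j x - \<delta> j x) has_real_derivative \<beta>' j x - \<delta>' j x) (at x within {a..b})" if "j < N"
      by (rule DERIV_diff[OF conjunct2[OF D1[OF x that]] conjunct2[OF D2[OF x that]]])
    show "\<alpha>' j x - \<gamma>' j x = (2 * real j + 1) * (\<beta> j x - \<delta> j x)" if "j < N"
      using conjunct1[OF E1[OF x], rule_format, OF that] conjunct1[OF E2[OF x], rule_format, OF that]
      by (simp add: algebra_simps)
    show "\<beta>' j x - \<delta>' j x = - 2 * (real j + 1) * (\<alpha> (j + 1) x - \<gamma> (j + 1) x)" if "j < N - 1"
      using conjunct1[OF conjunct2[OF E1[OF x]], rule_format, OF that]
        conjunct1[OF conjunct2[OF E2[OF x]], rule_format, OF that]
      by (simp add: algebra_simps)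
    show "\<beta>' (N - 1) x - \<delta>' (N - 1) x = 0"
      using conjunct2[OF conjunct2[OF E1[OF x]]] conjunct2[OF conjunct2[OF E2[OF x]]] by simp
  qed (simp_all add: init)
  then show ?thesis
    by simp
qed

text \<open>The coefficients are those of the Taylor polynomials of As 0 and Cs 0 in r^2 at c^2,
  hence linear in the chain values at r = c. Their x-derivatives come from the chain equations, and
  telescoping leaves only the values at index \<open>N\<close>, which are known from
  \<open>A\<close> and \<open>B\<close>.\<close>

lemma fueter_chain_odes:
  assumes N: "0 < N" and chain: "fueter_chain V As Cs" and S: "{a..b} \<times> {c..d} \<subseteq> V" and c: "0 < c" "c \<le> d"
    and A: "\<And>x r. x \<in> {a..b} \<Longrightarrow> r \<in> {c..d} \<Longrightarrow> real (double_fact (2 * N)) * As N x r = A (x, r)"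
    and C: "\<And>x r. x \<in> {a..b} \<Longrightarrow> r \<in> {c..d} \<Longrightarrow> real (double_fact (2 * N)) * Cs N x r = B (x, r) / r"
    and g: "\<And>x r. As 0 x r = Re (g (Complex x r))" "\<And>x r. Cs 0 x r = Im (g (Complex x r)) / r"
  defines "\<alpha> \<equiv> \<lambda>j x. radial_coeff N c (\<lambda>i. As i x c) j"
    and "\<beta> \<equiv> \<lambda>j x. radial_coeff N c (\<lambda>i. Cs i x c) j"
    and "\<alpha>' \<equiv> \<lambda>j x. radial_coeff N c (\<lambda>i. c\<^sup>2 * Cs (Suc i) x c + (2 * real i + 1) * Cs i x c) j"
    and "\<beta>' \<equiv> \<lambda>j x. radial_coeff N c (\<lambda>i. - As (Suc i) x c) j"
  shows "fueter_form N a b c d A B \<alpha> \<beta> g" "fueter_odes N a b c A B \<alpha> \<beta> \<alpha>' \<beta>'"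
proof -
  show "fueter_form N a b c d A B \<alpha> \<beta> g"
    unfolding fueter_form_def
  proof (intro ballI conjI)
    fix x r assume x: "x \<in> {a..b}" and r: "r \<in> {c..d}"
    have V: "(x, t) \<in> V" if "t \<in> {c..r}" for t
      using that S x r by auto
    show "Re (g (Complex x r)) = fueter_const N * integral {c..r} (\<lambda>t. t * (r\<^sup>2 - t\<^sup>2) ^ (N - 1) * A (x, t))
        + (\<Sum>j<N. \<alpha> j x * r ^ (2 * j))"
      unfolding g(1)[symmetric] \<alpha>_def
      by (rule fueter_chain_expansion[of c r N "\<lambda>i. As i x"])
         (use r N A x in \<open>auto intro!: fueter_chainD[OF chain] V\<close>)
    have "Cs 0 x r = fueter_const N * integral {c..r} (\<lambda>t. t * (r\<^sup>2 - t\<^sup>2) ^ (N - 1) * (B (x, t) / t))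
        + (\<Sum>j<N. \<beta> j x * r ^ (2 * j))"
      unfolding \<beta>_def
      by (rule fueter_chain_expansion[of c r N "\<lambda>i. Cs i x"])
         (use r N C x in \<open>auto intro!: fueter_chainD[OF chain] V\<close>)
    \<comment> \<open>The factor \<open>t\<close> of the remainder cancels the division in B / t, as
      t is at least c > 0.\<close>
    moreover have "integral {c..r} (\<lambda>t. t * (r\<^sup>2 - t\<^sup>2) ^ (N - 1) * (B (x, t) / t))
        = integral {c..r} (\<lambda>t. (r\<^sup>2 - t\<^sup>2) ^ (N - 1) * B (x, t))"
      using c(1) by (intro integral_cong) auto
    moreover have "Im (g (Complex x r)) = r * Cs 0 x r"
      using c(1) r by (simp add: g(2))
    ultimately show "Im (g (Complex x r)) = fueter_const N * r * integral {c..r} (\<lambda>t. (r\<^sup>2 - t\<^sup>2) ^ (N - 1) * B (x, t))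
        + (\<Sum>j<N. \<beta> j x * r ^ (2 * j + 1))"
      by (simp add: distrib_left sum_distrib_left mult_ac)
  qed
  obtain n where n: "N = Suc n"
    using N gr0_conv_Suc by blast
  then have n': "N - 1 = n" "N - j - 1 = n - j" for j
    by simp_all
  have K: "fueter_const N = 1 / (real (double_fact (2 * N)) * real (double_fact (2 * n)))"
    using fueter_const_eq[OF N] by (simp only: n')
  have pos: "real (double_fact (2 * N)) \<noteq> 0"
    using double_fact_even_pos[of N] by simp
  show "fueter_odes N a b c A B \<alpha> \<beta> \<alpha>' \<beta>'"
    unfolding fueter_odes_def
  proof (intro ballI allI impI conjI)
    fix x assume x: "x \<in> {a..b}"
    have V: "(x, c) \<in> V"
      using S x c by auto
    show "(\<alpha> j has_real_derivative \<alpha>' j x) (at x within {a..b})"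
      "(\<beta> j has_real_derivative \<beta>' j x) (at x within {a..b})" for j
      unfolding \<alpha>_def \<beta>_def \<alpha>'_def \<beta>'_def
      by (rule has_field_derivative_at_within, rule radial_coeff_has_derivative, rule fueter_chainD[OF chain V])+
    have A': "As N x c = A (x, c) / real (double_fact (2 * N))"
      and C': "Cs N x c = B (x, c) / c / real (double_fact (2 * N))"
      using A[of x c] C[of x c] x c pos by (simp_all add: field_simps)
    have power_neg: "(- c\<^sup>2) ^ l = (-1) ^ l * c ^ (2 * l)" for l
      using power_mult_distrib[of "-1" "c\<^sup>2" l] by (simp add: power_mult)
    show "\<alpha>' j x - (2 * real j + 1) * \<beta> j x =
        (-1) ^ (N - j - 1) * fueter_const N * real ((N - 1) choose j) * c ^ (2 * (N - j) - 1) * B (x, c)"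
      if j: "j < N" for j
    proof -
      \<comment> \<open>The odd exponent arises from the factor c^2 of
        \<open>radial_coeff_alpha\<close> and the division of B by c.\<close>
      have "c ^ (2 * (N - j) - 1) = c * c ^ (2 * (n - j))"
        using j by (simp add: n Suc_diff_le flip: power_Suc)
      note cpow = this
      have "\<alpha>' j x - (2 * real j + 1) * \<beta> j x
          = Cs N x c * c\<^sup>2 * (real (n choose j) * (- c\<^sup>2) ^ (n - j) / double_fact (2 * n))"
        unfolding \<alpha>'_def \<beta>_def n by (rule radial_coeff_alpha)
      also have "\<dots> = (-1) ^ (n - j) * fueter_const N * real (n choose j) * (c * c ^ (2 * (n - j))) * B (x, c)"
        unfolding C' K power_neg using c(1) by (simp add: power2_eq_square)
      finally show ?thesis
        by (simp only: cpow n')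
    qed
    have beta: "\<beta>' j x + 2 * (real j + 1) * \<alpha> (j + 1) x =
        - fueter_const N * ((-1) ^ (n - j) * real (n choose j) * c ^ (2 * (n - j))) * A (x, c)" for j
      using radial_coeff_beta[of n c "\<lambda>i. As i x c" j] A'
      by (simp add: \<beta>'_def \<alpha>_def n[symmetric] K power_neg mult_ac)
    show "\<beta>' j x + 2 * (real j + 1) * \<alpha> (j + 1) x =
        (-1) ^ (N - j) * fueter_const N * real ((N - 1) choose j) * c ^ (2 * (N - j - 1)) * A (x, c)"
      if j: "j < N - 1" for j
      using j unfolding beta by (simp add: n' n Suc_diff_le)
    \<comment> \<open>This is the preceding relation at the last index, where the coefficient with
      index \<open>N\<close> is 0.\<close>
    show "\<beta>' (N - 1) x = - fueter_const N * A (x, c)"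
      using beta[of n] by (simp add: n \<alpha>_def radial_coeff_eq_0)
  qed
qed

text \<open>By homogeneity, vanishing on one sphere spreads to every point. The origin is reached by
  scaling with 0, which also covers k = 0 since 0^0 = 1.\<close>

lemma hom_monogenic_poly_nonzero_on_sphere:
  fixes P :: "'m rvec \<Rightarrow> 'm::{finite,linorder} clifford"
  assumes P: "hom_monogenic_poly k P" "\<exists>x. P x \<noteq> 0" and r: "0 < r"
  obtains x where "norm x = r" "P x \<noteq> 0"
proof -
  have hom: "P (t *\<^sub>R x) = t ^ k *\<^sub>R P x" for t x
    using P(1) by (simp add: hom_monogenic_poly_def)
  obtain w :: "'m rvec" where w: "norm w = r"
    using vector_choose_size[of r] r by auto
  have "P y = 0" if zero: "\<And>x. norm x = r \<Longrightarrow> P x = 0" for y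
  proof (cases "y = 0")
    case True
    then show ?thesis
      using hom[of 0 w] zero[OF w] by simp
  next
    case False
    have "P y = P ((norm y / r) *\<^sub>R ((r / norm y) *\<^sub>R y))"
      using False r by simp
    also have "\<dots> = 0"
      using False r zero[of "(r / norm y) *\<^sub>R y"] by (simp only: hom) simp
    finally show ?thesis .
  qed
  then show ?thesis
    using P(2) that by blast
qed

text \<open>Both functions are real combinations of P x and of the vector x times P x, with
  coefficients depending only on the axial variables. Every sphere carries a point with P x nonzero,
  and independence there separates the two coefficients.\<close>

lemma fueter_map_eq_iff:
  fixes P :: "'m rvec \<Rightarrow> 'm::{finite,linorder} clifford"
  assumes P: "hom_monogenic_poly k P" "\<exists>x. P x \<noteq> 0" and m: "odd CARD('m)" "N = k + (CARD('m) - 1) div 2"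
    and U: "open U" "U \<subseteq> {z. Im z > 0}" and chain: "fueter_chain {(x, y). Complex x y \<in> U} As Cs"
    and g: "\<And>x r. As 0 x r = Re (g (Complex x r))" "\<And>x r. Cs 0 x r = Im (g (Complex x r)) / r"
    and S: "\<And>x r. (x, r) \<in> S \<Longrightarrow> Complex x r \<in> U"
    and H: "\<And>p. p \<in> axial_region S \<Longrightarrow> H p = axial_fun A B P p"
  shows "(\<forall>p\<in>axial_region S. fueter_map g k P p = H p) \<longleftrightarrow>
    (\<forall>(x, r)\<in>S. real (double_fact (2 * N)) * As N x r = A (x, r) \<and>
      real (double_fact (2 * N)) * Cs N x r = B (x, r) / r)"
proof -
  let ?D = "real (double_fact (2 * N))"
  have diff: "fueter_map g k P (x0, x) - H (x0, x) =
      (?D * As N x0 (norm x) - A (x0, norm x)) *\<^sub>R P x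
      + (?D * Cs N x0 (norm x) - B (x0, norm x) / norm x) *\<^sub>R (cl_vector x \<cdot>\<^sub>C P x)"
    if "(x0, norm x) \<in> S" for x0 and x :: "'m rvec"
  proof -
    have "Complex x0 (norm x) \<in> U" "x \<noteq> 0" "(x0, x) \<in> axial_region S"
      using S[OF that] U(2) that by (auto simp: axial_region_def)
    then show ?thesis
      by (simp add: fueter_map_eq[OF P(1) m U chain g] H axial_fun_eq algebra_simps)
  qed
  show ?thesis
  proof (intro iffI ballI; clarify)
    fix x0 r assume eq: "\<forall>p\<in>axial_region S. fueter_map g k P p = H p" and p: "(x0, r) \<in> S"
    have r: "0 < r"
      using S[OF p] U(2) by auto
    obtain x where x: "norm x = r" "P x \<noteq> 0"
      using hom_monogenic_poly_nonzero_on_sphere[OF P r] .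
    have "(x0, x) \<in> axial_region S"
      using p x by (simp add: axial_region_def)
    then have "fueter_map g k P (x0, x) - H (x0, x) = 0"
      using eq by simp
    moreover have "x \<noteq> 0"
      using x r by auto
    ultimately show "?D * As N x0 r = A (x0, r) \<and> ?D * Cs N x0 r = B (x0, r) / r"
      using cl_vector_independent[of _ "P x" _ x] diff[of x0 x] p x by fastforce
  next
    fix x0 and x :: "'m rvec"
    assume eq: "\<forall>(x, r)\<in>S. ?D * As N x r = A (x, r) \<and> ?D * Cs N x r = B (x, r) / r"
      and p: "(x0, x) \<in> axial_region S"
    then have S': "(x0, norm x) \<in> S"
      by (simp add: axial_region_def)
    with eq have "?D * As N x0 (norm x) = A (x0, norm x)" "?D * Cs N x0 (norm x) = B (x0, norm x) / norm x"
      by auto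
    with diff[OF S'] show "fueter_map g k P (x0, x) = H (x0, x)"
      by simp
  qed
qed

section \<open>Necessity, existence and sufficiency\<close>

lemma axial_monogenic_eq:
  assumes "axial_monogenic k P S A B H" "p \<in> axial_region S"
  shows "H p = axial_fun A B P p"
proof -
  obtain V where V: "S \<subseteq> V" "\<forall>p\<in>axial_region V. H p = axial_fun A B P p"
    using assms(1) unfolding axial_monogenic_def by blast
  have "p \<in> axial_region V"
    using assms(2) V(1) by (auto simp: axial_region_def)
  with V(2) show ?thesis
    by blast
qed

lemma fueter_primitive_form:
  fixes P :: "'m rvec \<Rightarrow> 'm::{finite,linorder} clifford"
  assumes P: "hom_monogenic_poly k P" "\<exists>x. P x \<noteq> 0" and m: "odd CARD('m)" "N = k + (CARD('m) - 1) div 2"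
    and N: "0 < N" and c: "0 < c" "c \<le> d"
    and H: "\<And>p. p \<in> axial_region ({a..b} \<times> {c..d}) \<Longrightarrow> H p = axial_fun A B P p"
    and h: "fueter_primitive k P ({a..b} \<times> {c..d}) H h"
  shows "\<exists>\<alpha> \<beta> \<alpha>' \<beta>'. fueter_form N a b c d A B \<alpha> \<beta> h \<and> fueter_odes N a b c A B \<alpha> \<beta> \<alpha>' \<beta>'"
proof -
  let ?S = "{a..b} \<times> {c..d}"
  obtain U g where U: "open U" "U \<subseteq> {z. Im z > 0}" and g: "g holomorphic_on U"
    and S: "\<And>x r. (x, r) \<in> ?S \<Longrightarrow> Complex x r \<in> U"
    and gh: "\<And>x r. (x, r) \<in> ?S \<Longrightarrow> g (Complex x r) = h (Complex x r)"
    and eq: "\<forall>p\<in>axial_region ?S. fueter_map g k P p = H p"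
    using h unfolding fueter_primitive_def by blast
  \<comment> \<open>The chain is that of the holomorphic extension \<open>g\<close>; it coincides
    with \<open>h\<close> on the rectangle, where the formulas are claimed.\<close>
  obtain As Cs where chain: "fueter_chain {(x, y). Complex x y \<in> U} As Cs"
    and 0: "\<And>x r. As 0 x r = Re (g (Complex x r))" "\<And>x r. Cs 0 x r = Im (g (Complex x r)) / r"
    using holomorphic_fueter_chain[OF g U] by blast
  have top: "\<forall>(x, r)\<in>?S. real (double_fact (2 * N)) * As N x r = A (x, r) \<and>
      real (double_fact (2 * N)) * Cs N x r = B (x, r) / r"
    using fueter_map_eq_iff[OF P m U chain 0 S H] eq by blast
  have sub: "?S \<subseteq> {(x, y). Complex x y \<in> U}"
    using S by auto
  have "fueter_form N a b c d A B (\<lambda>j x. radial_coeff N c (\<lambda>i. As i x c) j)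
      (\<lambda>j x. radial_coeff N c (\<lambda>i. Cs i x c) j) g"
    by (rule fueter_chain_odes(1)[OF N chain sub c _ _ 0]) (use top in auto)
  moreover have "fueter_odes N a b c A B (\<lambda>j x. radial_coeff N c (\<lambda>i. As i x c) j)
      (\<lambda>j x. radial_coeff N c (\<lambda>i. Cs i x c) j)
      (\<lambda>j x. radial_coeff N c (\<lambda>i. c\<^sup>2 * Cs (Suc i) x c + (2 * real i + 1) * Cs i x c) j)
      (\<lambda>j x. radial_coeff N c (\<lambda>i. - As (Suc i) x c) j)"
    by (rule fueter_chain_odes(2)[OF N chain sub c _ _ 0]) (use top in auto)
  ultimately show ?thesis
    using gh unfolding fueter_form_def by (auto intro!: exI)
qed

text \<open>Existence holds with prescribed coefficients at the left end \<open>a\<close>; the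
  converse direction needs this freedom. Each of the \<open>N\<close> descents leaves two values at
  \<open>(a, c)\<close> free, matching the 2 N initial values.\<close>

lemma fueter_primitive_exists:
  fixes P :: "'m rvec \<Rightarrow> 'm::{finite,linorder} clifford"
  assumes P: "hom_monogenic_poly k P" "\<exists>x. P x \<noteq> 0" and m: "odd CARD('m)" "N = k + (CARD('m) - 1) div 2"
    and N: "0 < N" and ab: "a \<le> b" and c: "0 < c" "c \<le> d"
    and AB: "axial_monogenic k P ({a..b} \<times> {c..d}) A B H"
  obtains g \<gamma> \<delta> \<gamma>' \<delta>' where "fueter_primitive k P ({a..b} \<times> {c..d}) H g"
    "fueter_form N a b c d A B \<gamma> \<delta> g" "fueter_odes N a b c A B \<gamma> \<delta> \<gamma>' \<delta>'"
    "\<And>j. j < N \<Longrightarrow> \<gamma> j a = \<alpha> j" "\<And>j. j < N \<Longrightarrow> \<delta> j a = \<beta> j"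
proof -
  let ?S = "{a..b} \<times> {c..d}" and ?D = "real (double_fact (2 * N))"
  obtain V where V: "open V" "?S \<subseteq> V" "V \<subseteq> UNIV \<times> {0<..}" "C1_on A V" "C1_on B V"
    "vekua_system CARD('m) k A B V" "\<forall>p\<in>axial_region V. H p = axial_fun A B P p"
    using AB unfolding axial_monogenic_def by blast
  have H: "H p = axial_fun A B P p" if "p \<in> axial_region ?S" for p
    by (rule axial_monogenic_eq[OF AB that])
  have "2 * N + 1 = 2 * k + CARD('m)"
    using m by (auto elim!: oddE)
  from arg_cong[OF this, of real] have "2 * real N = 2 * real k + real CARD('m) - 1"
    by simp
  note pair = vekua_system_imp_vekua_pair[OF V(3-6) this, of ?D]
  have "compact ?S"
    by (intro compact_Times) auto
  then obtain e where e: "e > 0" "(\<Union>x\<in>?S. ball x e) \<subseteq> V"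
    using compact_subset_open_imp_ball_epsilon_subset[OF _ V(1,2)] by blast
  \<comment> \<open>\<open>V\<close> need not be convex. The sum of the rectangle and a small ball
    is an open convex neighbourhood inside \<open>V\<close>, as the Poincare lemma requires.\<close>
  define W where "W = (\<Union>x\<in>?S. \<Union>y\<in>ball 0 e. {x + y})"
  have W_eq: "W = (\<Union>x\<in>?S. ball x e)"
  proof -
    have "(\<Union>y\<in>ball 0 e. {x + y}) = ball x e" for x :: "real \<times> real"
      using ball_translation[of x 0 e] by (auto simp: image_def)
    then show ?thesis
      by (simp add: W_def)
  qed
  have W: "open W" "convex W" "(a, c) \<in> W" "W \<subseteq> V" "?S \<subseteq> W"
  proof -
    show "open W" "W \<subseteq> V"
      using e(2) by (auto simp: W_eq)
    show "convex W"
      unfolding W_def by (intro convex_sums convex_Times) auto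
    show "?S \<subseteq> W"
      using e(1) by (force simp: W_eq)
    then show "(a, c) \<in> W"
      using ab c by auto
  qed
  \<comment> \<open>The prescribed coefficients are translated into chain values at
    \<open>(a, c)\<close>.\<close>
  obtain y z where y: "\<forall>j<N. radial_coeff N c y j = \<alpha> j" and z: "\<forall>j<N. radial_coeff N c z j = \<beta> j"
    using radial_coeff_surj by metis
  obtain g As Cs where g: "g holomorphic_on {z. (Re z, Im z) \<in> W}"
    and chain: "fueter_chain W As Cs"
    and 0: "\<And>x r. As 0 x r = Re (g (Complex x r))" "\<And>x r. Cs 0 x r = Im (g (Complex x r)) / r"
    and top: "\<And>x r. (x, r) \<in> W \<Longrightarrow> As N x r = A (x, r) / ?D"
      "\<And>x r. (x, r) \<in> W \<Longrightarrow> Cs N x r = B (x, r) / snd (x, r) / ?D"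
    and init: "\<And>s. s < N \<Longrightarrow> As s (fst (a, c)) (snd (a, c)) = y s"
      "\<And>s. s < N \<Longrightarrow> Cs s (fst (a, c)) (snd (a, c)) = z s"
    by (rule vekua_pair_holomorphic[OF W(1-3) subset_trans[OF W(4) V(3)]
          vekua_pair_subset[OF pair W(4)] N, of y z]) (rule that)
  define U where "U = {z. (Re z, Im z) \<in> W}"
  note g = g[folded U_def]
  have "open ((\<lambda>z. (Re z, Im z)) -` W)"
    by (intro open_vimage W continuous_intros)
  then have U: "open U" "U \<subseteq> {z. Im z > 0}" "{(x, y). Complex x y \<in> U} = W"
    using W(4) V(3) by (auto simp: U_def vimage_def)
  have pos: "?D \<noteq> 0"
    using double_fact_even_pos[of N] by simp
  have top': "?D * As N x r = A (x, r)" "?D * Cs N x r = B (x, r) / r" if "x \<in> {a..b}" "r \<in> {c..d}" for x r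
  proof -
    have "(x, r) \<in> W"
      using that W(5) by auto
    from top[OF this] show "?D * As N x r = A (x, r)" "?D * Cs N x r = B (x, r) / r"
      using pos by simp_all
  qed
  have S_U: "Complex x r \<in> U" if "(x, r) \<in> ?S" for x r
    using W(5) that by (auto simp: U_def)
  have "\<forall>p\<in>axial_region ?S. fueter_map g k P p = H p"
    using top' by (subst fueter_map_eq_iff[OF P m U(1,2) chain[folded U(3)] 0 S_U H]) auto
  then have prim: "fueter_primitive k P ?S H g"
    unfolding fueter_primitive_def using U(1,2) g S_U
    by (intro exI[of _ U] exI[of _ g]) auto
  show ?thesis
  proof (rule that[OF prim fueter_chain_odes[OF N chain W(5) c top' 0]])
    have "radial_coeff N c (\<lambda>i. As i a c) j = radial_coeff N c y j"
      "radial_coeff N c (\<lambda>i. Cs i a c) j = radial_coeff N c z j" for j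
      using init unfolding radial_coeff_def by (intro sum.cong; simp)+
    then show "radial_coeff N c (\<lambda>i. As i a c) j = \<alpha> j" "radial_coeff N c (\<lambda>i. Cs i a c) j = \<beta> j"
      if "j < N" for j
      using y z that by auto
  qed
qed

text \<open>A primitive \<open>g\<close> with the same coefficients at \<open>a\<close> exists, and
  uniqueness for the differential equations makes them equal on all of [a, b]. Thus \<open>h\<close>
  and \<open>g\<close> agree on the rectangle, and being a primitive depends only on the values
  there.\<close>

lemma fueter_form_imp_primitive:
  fixes P :: "'m rvec \<Rightarrow> 'm::{finite,linorder} clifford"
  assumes P: "hom_monogenic_poly k P" "\<exists>x. P x \<noteq> 0" and m: "odd CARD('m)" "N = k + (CARD('m) - 1) div 2"
    and N: "0 < N" and ab: "a \<le> b" and c: "0 < c" "c \<le> d"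
    and AB: "axial_monogenic k P ({a..b} \<times> {c..d}) A B H"
    and form: "fueter_form N a b c d A B \<alpha> \<beta> h" and odes: "fueter_odes N a b c A B \<alpha> \<beta> \<alpha>' \<beta>'"
  shows "fueter_primitive k P ({a..b} \<times> {c..d}) H h"
proof -
  obtain g \<gamma> \<delta> \<gamma>' \<delta>' where g: "fueter_primitive k P ({a..b} \<times> {c..d}) H g"
    "fueter_form N a b c d A B \<gamma> \<delta> g" "fueter_odes N a b c A B \<gamma> \<delta> \<gamma>' \<delta>'"
    and init: "\<And>j. j < N \<Longrightarrow> \<gamma> j a = \<alpha> j a" "\<And>j. j < N \<Longrightarrow> \<delta> j a = \<beta> j a"
    using fueter_primitive_exists[OF P m N ab c AB, of "\<lambda>j. \<alpha> j a" "\<lambda>j. \<beta> j a"] by blast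
  have eq: "\<gamma> j x = \<alpha> j x \<and> \<delta> j x = \<beta> j x" if "x \<in> {a..b}" "j < N" for x j
    using fueter_odes_unique[OF g(3) odes init that] .
  have gh: "g (Complex x r) = h (Complex x r)" if "x \<in> {a..b}" "r \<in> {c..d}" for x r
    using form g(2) that unfolding fueter_form_def by (intro complex_eqI) (simp_all add: eq)
  obtain U g' where g': "open U \<and> U \<subseteq> {z. Im z > 0} \<and>
      (\<forall>(x, y)\<in>{a..b} \<times> {c..d}. Complex x y \<in> U \<and> g' (Complex x y) = g (Complex x y)) \<and>
      g' holomorphic_on U \<and>
      (\<forall>p\<in>axial_region ({a..b} \<times> {c..d}). fueter_map g' k P p = H p)"
    using g(1) unfolding fueter_primitive_def by (elim exE)
  then have "\<forall>(x, y)\<in>{a..b} \<times> {c..d}. Complex x y \<in> U \<and> g' (Complex x y) = h (Complex x y)"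
    using gh by auto
  with g' show ?thesis
    unfolding fueter_primitive_def by (intro exI[of _ U] exI[of _ g']) simp
qed

theorem theorem3:
  fixes P :: "'m rvec \<Rightarrow> 'm::{finite,linorder} clifford"
    and A B :: "real \<times> real \<Rightarrow> real"
    and H :: "'m paravector \<Rightarrow> 'm clifford"
    and a b c d :: real
    and k N :: nat
  assumes "CARD('m) \<ge> 3" and "odd CARD('m)"
    and "N = k + (CARD('m) - 1) div 2"
    and "hom_monogenic_poly k P" and "\<exists>x. P x \<noteq> 0"
    and "a < b" and "0 < c" and "c < d"
    and "axial_monogenic k P ({a..b} \<times> {c..d}) A B H"
  shows "(\<exists>h. fueter_primitive k P ({a..b} \<times> {c..d}) H h) \<and>
    (\<forall>h. fueter_primitive k P ({a..b} \<times> {c..d}) H h \<longleftrightarrow>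
      (\<exists>\<alpha> \<beta> \<alpha>' \<beta>' :: nat \<Rightarrow> real \<Rightarrow> real.
        (\<forall>x0\<in>{a..b}. \<forall>r\<in>{c..d}.
          Re (h (Complex x0 r)) =
            fueter_const N * integral {c..r} (\<lambda>t. t * (r\<^sup>2 - t\<^sup>2) ^ (N - 1) * A (x0, t))
            + (\<Sum>j<N. \<alpha> j x0 * r ^ (2 * j)) \<and>
          Im (h (Complex x0 r)) =
            fueter_const N * r * integral {c..r} (\<lambda>t. (r\<^sup>2 - t\<^sup>2) ^ (N - 1) * B (x0, t))
            + (\<Sum>j<N. \<beta> j x0 * r ^ (2 * j + 1))) \<and>
        (\<forall>x0\<in>{a..b}. \<forall>j<N.
          (\<alpha> j has_real_derivative \<alpha>' j x0) (at x0 within {a..b}) \<and>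
          (\<beta> j has_real_derivative \<beta>' j x0) (at x0 within {a..b})) \<and>
        (\<forall>x0\<in>{a..b}.
          (\<forall>j<N. \<alpha>' j x0 - (2 * real j + 1) * \<beta> j x0 =
            (-1) ^ (N - j - 1) * fueter_const N * real ((N - 1) choose j)
              * c ^ (2 * (N - j) - 1) * B (x0, c)) \<and>
          (\<forall>j<N - 1. \<beta>' j x0 + 2 * (real j + 1) * \<alpha> (j + 1) x0 =
            (-1) ^ (N - j) * fueter_const N * real ((N - 1) choose j)
              * c ^ (2 * (N - j - 1)) * A (x0, c)) \<and>
          \<beta>' (N - 1) x0 = - fueter_const N * A (x0, c))))"
  unfolding fueter_form_def[symmetric] fueter_odes_def[symmetric]
proof (intro conjI allI iffI)
  \<comment> \<open>The dimension bound m \<ge> 3 makes \<open>N\<close> positive even for k =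
    0.\<close>
  have N: "0 < N"
    using assms(1,3) by auto
  have H: "H p = axial_fun A B P p" if "p \<in> axial_region ({a..b} \<times> {c..d})" for p
    by (rule axial_monogenic_eq[OF assms(9) that])
  show "\<exists>h. fueter_primitive k P ({a..b} \<times> {c..d}) H h"
    using fueter_primitive_exists[OF assms(4,5,2,3) N less_imp_le[OF assms(6)] assms(7) less_imp_le[OF assms(8)] assms(9)]
    by blast
  show "\<exists>\<alpha> \<beta> \<alpha>' \<beta>'. fueter_form N a b c d A B \<alpha> \<beta> h \<and> fueter_odes N a b c A B \<alpha> \<beta> \<alpha>' \<beta>'"
    if "fueter_primitive k P ({a..b} \<times> {c..d}) H h" for h
    by (rule fueter_primitive_form[OF assms(4,5,2,3) N assms(7) less_imp_le[OF assms(8)] H that])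
  show "fueter_primitive k P ({a..b} \<times> {c..d}) H h"
    if "\<exists>\<alpha> \<beta> \<alpha>' \<beta>'. fueter_form N a b c d A B \<alpha> \<beta> h \<and> fueter_odes N a b c A B \<alpha> \<beta> \<alpha>' \<beta>'" for h
    using that fueter_form_imp_primitive[OF assms(4,5,2,3) N less_imp_le[OF assms(6)] assms(7)
        less_imp_le[OF assms(8)] assms(9)] by blast
qed

end
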